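(* Let $Q$ be an algebraic group with Lie algebra $\mathfrak q$, let $\rho:Q\to GL(V)$ be an arbitrary linear representation, and let $\dim V=n$. Then the representation $(Q:mV^* )$ has GIB for any $m\ge n$. In this case, $\mathrm{ind}(\mathfrak q,mV^* )=nm-\dim\mathfrak q$.
   Context: The ground field $\Bbbk$ is algebraically closed of characteristic zero; representations are finite-dimensional and rational. $mV^*$ is the direct sum of $m$ copies of the dual module $V^*$, and $(Q:U)$ denotes the representation of $Q$ on a $Q$-module $U$. For a Lie algebra $\mathfrak q$ and a finite-dimensional $\mathfrak q$-module $U$, the index is $\mathrm{ind}(\mathfrak q,U)=\dim U-\max_{\xi\in U^*}\dim(\mathfrak q\cdot\xi)$. For $v\in U$, $\mathfrak q_v$ is the stabiliser of $v$ in $\mathfrak q$, and $U/\mathfrak q\cdot v$ is a $\mathfrak q_v$-module. A representation $(Q:U)$ has good index behaviour (GIB) if $\mathrm{ind}(\mathfrak q,U^* )=\mathrm{ind}(\mathfrak q_v,(U/\mathfrak q\cdot v)^* )$ for every $v\in U$.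
   Formalization: The formula ind(q,mV* ) = nm − dim q fails when dρ is not injective (e.g. trivial ρ, dim q > 0), so it is stated as nm − (dim q − dim ker dρ) for arbitrary ρ, and as nm − dim q when ker dρ = 0; GIB is for arbitrary ρ. *)

theory Defs
  imports "Jordan_Normal_Form.VS_Connect" "HOL-Algebra.AbelCoset"
begin

section \<open>Vector spaces\<close>

text \<open>The ground field is the type \<open>'k\<close>, viewed as the ring \<open>class_ring\<close>; vector spaces are
  \<open>vectorspace class_ring V\<close> with explicit carriers. The \<open>mult\<close> and \<open>one\<close> fields of the module
  record carry no meaning for a vector space and are filled arbitrarily.\<close>

abbreviation vdim :: "('k :: field, 'v) module \<Rightarrow> nat" where
  "vdim V \<equiv> vectorspace.dim class_ring V"

definition dual :: "('k :: field, 'v) module \<Rightarrow> ('k, 'v \<Rightarrow> 'k) module" where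
  "dual V = (ring.func_space class_ring (carrier V))
     \<lparr>carrier := {\<phi> \<in> carrier V \<rightarrow>\<^sub>E UNIV.
        (\<forall>v\<in>carrier V. \<forall>w\<in>carrier V. \<phi> (v \<oplus>\<^bsub>V\<^esub> w) = \<phi> v + \<phi> w) \<and>
        (\<forall>c. \<forall>v\<in>carrier V. \<phi> (c \<odot>\<^bsub>V\<^esub> v) = c * \<phi> v)}\<rparr>"

definition copies :: "nat \<Rightarrow> ('k, 'v) module \<Rightarrow> ('k, nat \<Rightarrow> 'v) module" where
  "copies m V = \<lparr>carrier = {..<m} \<rightarrow>\<^sub>E carrier V,
     mult = (\<lambda>u w. \<lambda>i\<in>{..<m}. \<zero>\<^bsub>V\<^esub>), one = (\<lambda>i\<in>{..<m}. \<zero>\<^bsub>V\<^esub>),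
     zero = (\<lambda>i\<in>{..<m}. \<zero>\<^bsub>V\<^esub>),
     add = (\<lambda>u w. \<lambda>i\<in>{..<m}. u i \<oplus>\<^bsub>V\<^esub> w i),
     smult = (\<lambda>c u. \<lambda>i\<in>{..<m}. c \<odot>\<^bsub>V\<^esub> u i)\<rparr>"

text \<open>The multiple \<open>c \<cdot> A\<close> of a coset \<open>A\<close> is \<open>c a + W\<close> for any \<open>a \<in> A\<close>; the elementwise image
  alone would be wrong for \<open>c = 0\<close>. The same remark applies to \<open>quotient_act\<close> below.\<close>

definition quotient_space :: "('k, 'v) module \<Rightarrow> 'v set \<Rightarrow> ('k, 'v set) module" where
  "quotient_space V W = \<lparr>carrier = a_rcosets\<^bsub>V\<^esub> W,
     mult = (\<lambda>A B. W), one = W, zero = W,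
     add = (\<lambda>A B. A <+>\<^bsub>V\<^esub> B),
     smult = (\<lambda>c A. \<Union>a\<in>A. W +>\<^bsub>V\<^esub> (c \<odot>\<^bsub>V\<^esub> a))\<rparr>"

section \<open>Index of modules over a Lie algebra\<close>

text \<open>A module over a Lie algebra \<open>q\<close> is given by a vector space \<open>U\<close> and the action
  \<open>act :: 'q \<Rightarrow> 'u \<Rightarrow> 'u\<close>, written \<open>x \<cdot> u\<close> in the remarks. The bracket of \<open>q\<close> does not occur
  in the definition of the index.\<close>

definition dual_act ::
  "('k :: field, 'u) module \<Rightarrow> ('q \<Rightarrow> 'u \<Rightarrow> 'u) \<Rightarrow> 'q \<Rightarrow> ('u \<Rightarrow> 'k) \<Rightarrow> ('u \<Rightarrow> 'k)" where
  "dual_act U act x \<xi> = (\<lambda>u\<in>carrier U. - \<xi> (act x u))"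

definition quotient_act ::
  "('k, 'u) module \<Rightarrow> 'u set \<Rightarrow> ('q \<Rightarrow> 'u \<Rightarrow> 'u) \<Rightarrow> 'q \<Rightarrow> 'u set \<Rightarrow> 'u set" where
  "quotient_act U W act x A = (\<Union>a\<in>A. W +>\<^bsub>U\<^esub> (act x a))"

definition orbit_tangent :: "('k, 'q) module \<Rightarrow> ('q \<Rightarrow> 'u \<Rightarrow> 'u) \<Rightarrow> 'u \<Rightarrow> 'u set" where
  "orbit_tangent q act u = (\<lambda>x. act x u) ` carrier q"

definition stabiliser ::
  "('k, 'q) module \<Rightarrow> ('k, 'u) module \<Rightarrow> ('q \<Rightarrow> 'u \<Rightarrow> 'u) \<Rightarrow> 'u \<Rightarrow> ('k, 'q) module" where
  "stabiliser q U act v = q\<lparr>carrier := {x \<in> carrier q. act x v = \<zero>\<^bsub>U\<^esub>}\<rparr>"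

definition ind ::
  "('k :: field, 'q) module \<Rightarrow> ('k, 'u) module \<Rightarrow> ('q \<Rightarrow> 'u \<Rightarrow> 'u) \<Rightarrow> int" where
  "ind q U act = int (vdim U) -
     int (Max ((\<lambda>\<xi>. vdim ((dual U)\<lparr>carrier := orbit_tangent q (dual_act U act) \<xi>\<rparr>))
                 ` carrier (dual U)))"

section \<open>Affine algebraic groups\<close>

text \<open>An affine variety over an algebraically closed field is a set \<open>X\<close> of points together with
  its coordinate ring \<open>A = k[X]\<close>, a finitely generated algebra of functions on \<open>X\<close> such that
  evaluation is a bijection from \<open>X\<close> onto the algebra homomorphisms \<open>A \<rightarrow> k\<close>. Functions on \<open>X\<close>
  are elements of \<open>X \<rightarrow>\<^sub>E UNIV\<close>.\<close>

definition function_algebra :: "'g set \<Rightarrow> ('g \<Rightarrow> 'k :: field) set \<Rightarrow> bool" where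
  "function_algebra X A \<longleftrightarrow> A \<subseteq> X \<rightarrow>\<^sub>E UNIV \<and>
     (\<forall>c. (\<lambda>x\<in>X. c) \<in> A) \<and>
     (\<forall>f\<in>A. \<forall>h\<in>A. (\<lambda>x\<in>X. f x + h x) \<in> A) \<and>
     (\<forall>f\<in>A. \<forall>h\<in>A. (\<lambda>x\<in>X. f x * h x) \<in> A)"

definition algebra_character ::
  "'g set \<Rightarrow> ('g \<Rightarrow> 'k :: field) set \<Rightarrow> (('g \<Rightarrow> 'k) \<Rightarrow> 'k) \<Rightarrow> bool" where
  "algebra_character X A \<chi> \<longleftrightarrow>
     (\<forall>c. \<chi> (\<lambda>x\<in>X. c) = c) \<and>
     (\<forall>f\<in>A. \<forall>h\<in>A. \<chi> (\<lambda>x\<in>X. f x + h x) = \<chi> f + \<chi> h) \<and>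
     (\<forall>f\<in>A. \<forall>h\<in>A. \<chi> (\<lambda>x\<in>X. f x * h x) = \<chi> f * \<chi> h)"

locale affine_variety =
  fixes X :: "'g set" and A :: "('g \<Rightarrow> 'k :: field) set"
  assumes function_algebra: "function_algebra X A"
    and finitely_generated:
      "\<exists>S. finite S \<and> S \<subseteq> A \<and> (\<forall>B. function_algebra X B \<and> S \<subseteq> B \<longrightarrow> A \<subseteq> B)"
    and points_separated: "x \<in> X \<Longrightarrow> y \<in> X \<Longrightarrow> (\<And>f. f \<in> A \<Longrightarrow> f x = f y) \<Longrightarrow> x = y"
    and characters_are_points: "algebra_character X A \<chi> \<Longrightarrow> \<exists>x\<in>X. \<forall>f\<in>A. \<chi> f = f x"

text \<open>Multiplication is a morphism iff the function \<open>(x, y) \<mapsto> f (x y)\<close> lies in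
  \<open>k[Q \<times> Q] = k[Q] \<otimes> k[Q]\<close> for all \<open>f \<in> k[Q]\<close>.\<close>

locale affine_algebraic_group =
  group Q + affine_variety "carrier Q" A
  for Q (structure) and A :: "('g \<Rightarrow> 'k :: field) set" +
  assumes mult_morphism:
      "f \<in> A \<Longrightarrow> \<exists>(N :: nat) a b. (\<forall>i<N. a i \<in> A \<and> b i \<in> A) \<and>
         (\<forall>x\<in>carrier Q. \<forall>y\<in>carrier Q. f (x \<otimes> y) = (\<Sum>i<N. a i x * b i y))"
    and inv_morphism: "f \<in> A \<Longrightarrow> (\<lambda>x\<in>carrier Q. f (inv x)) \<in> A"

definition left_translate ::
  "('g, 'z) monoid_scheme \<Rightarrow> 'g \<Rightarrow> ('g \<Rightarrow> 'k) \<Rightarrow> ('g \<Rightarrow> 'k)" where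
  "left_translate Q g f = (\<lambda>x\<in>carrier Q. f (inv\<^bsub>Q\<^esub> g \<otimes>\<^bsub>Q\<^esub> x))"

text \<open>The Lie algebra of \<open>Q\<close> consists of the left-invariant derivations of \<open>k[Q]\<close>. The \<open>mult\<close>
  field of the record is the Lie bracket, i.e. the commutator of derivations.\<close>

definition lie_algebra_of ::
  "('g, 'z) monoid_scheme \<Rightarrow> ('g \<Rightarrow> 'k :: field) set \<Rightarrow>
    ('k, ('g \<Rightarrow> 'k) \<Rightarrow> ('g \<Rightarrow> 'k)) module" where
  "lie_algebra_of Q A = \<lparr>
     carrier = {D \<in> A \<rightarrow>\<^sub>E A.
       (\<forall>f\<in>A. \<forall>h\<in>A. D (\<lambda>x\<in>carrier Q. f x + h x) = (\<lambda>x\<in>carrier Q. D f x + D h x)) \<and>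
       (\<forall>c. \<forall>f\<in>A. D (\<lambda>x\<in>carrier Q. c * f x) = (\<lambda>x\<in>carrier Q. c * D f x)) \<and>
       (\<forall>f\<in>A. \<forall>h\<in>A. D (\<lambda>x\<in>carrier Q. f x * h x) =
          (\<lambda>x\<in>carrier Q. D f x * h x + f x * D h x)) \<and>
       (\<forall>g\<in>carrier Q. \<forall>f\<in>A. D (left_translate Q g f) = left_translate Q g (D f))},
     mult = (\<lambda>D E. \<lambda>f\<in>A. \<lambda>x\<in>carrier Q. D (E f) x - E (D f) x),
     one = (\<lambda>f\<in>A. \<lambda>x\<in>carrier Q. 0),
     zero = (\<lambda>f\<in>A. \<lambda>x\<in>carrier Q. 0),
     add = (\<lambda>D E. \<lambda>f\<in>A. \<lambda>x\<in>carrier Q. D f x + E f x),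
     smult = (\<lambda>c D. \<lambda>f\<in>A. \<lambda>x\<in>carrier Q. c * D f x)\<rparr>"

section \<open>Rational representations\<close>

definition matrix_coeff ::
  "('g, 'z) monoid_scheme \<Rightarrow> ('g \<Rightarrow> 'u \<Rightarrow> 'u) \<Rightarrow> ('u \<Rightarrow> 'k) \<Rightarrow> 'u \<Rightarrow> ('g \<Rightarrow> 'k)" where
  "matrix_coeff Q \<rho> \<phi> u = (\<lambda>g\<in>carrier Q. \<phi> (\<rho> g u))"

definition rational_rep ::
  "('g, 'z) monoid_scheme \<Rightarrow> ('g \<Rightarrow> 'k :: field) set \<Rightarrow> ('k, 'u) module \<Rightarrow>
    ('g \<Rightarrow> 'u \<Rightarrow> 'u) \<Rightarrow> bool" where
  "rational_rep Q A U \<rho> \<longleftrightarrow>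
     vectorspace class_ring U \<and> vectorspace.fin_dim class_ring U \<and>
     (\<forall>g\<in>carrier Q. linear_map class_ring U U (\<rho> g)) \<and>
     (\<forall>u\<in>carrier U. \<rho> \<one>\<^bsub>Q\<^esub> u = u) \<and>
     (\<forall>g\<in>carrier Q. \<forall>h\<in>carrier Q. \<forall>u\<in>carrier U. \<rho> (g \<otimes>\<^bsub>Q\<^esub> h) u = \<rho> g (\<rho> h u)) \<and>
     (\<forall>\<phi>\<in>carrier (dual U). \<forall>u\<in>carrier U. matrix_coeff Q \<rho> \<phi> u \<in> A)"

text \<open>The differential at the identity: \<open>d\<rho>(D) u\<close> is the vector with
  \<open>\<phi> (d\<rho>(D) u) = (D c)(1)\<close> for every \<open>\<phi> \<in> U\<^sup>*\<close>, where \<open>c(g) = \<phi> (\<rho>(g) u)\<close>.\<close>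

definition differential ::
  "('g, 'z) monoid_scheme \<Rightarrow> ('k :: field, 'u) module \<Rightarrow> ('g \<Rightarrow> 'u \<Rightarrow> 'u) \<Rightarrow>
    (('g \<Rightarrow> 'k) \<Rightarrow> ('g \<Rightarrow> 'k)) \<Rightarrow> 'u \<Rightarrow> 'u" where
  "differential Q U \<rho> D u =
     (THE w. w \<in> carrier U \<and>
        (\<forall>\<phi>\<in>carrier (dual U). \<phi> w = D (matrix_coeff Q \<rho> \<phi> u) \<one>\<^bsub>Q\<^esub>))"

definition dual_rep ::
  "('g, 'z) monoid_scheme \<Rightarrow> ('k, 'u) module \<Rightarrow> ('g \<Rightarrow> 'u \<Rightarrow> 'u) \<Rightarrow>
    'g \<Rightarrow> ('u \<Rightarrow> 'k) \<Rightarrow> ('u \<Rightarrow> 'k)" where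
  "dual_rep Q U \<rho> g \<phi> = (\<lambda>u\<in>carrier U. \<phi> (\<rho> (inv\<^bsub>Q\<^esub> g) u))"

definition copies_rep :: "nat \<Rightarrow> ('g \<Rightarrow> 'u \<Rightarrow> 'u) \<Rightarrow> 'g \<Rightarrow> (nat \<Rightarrow> 'u) \<Rightarrow> (nat \<Rightarrow> 'u)" where
  "copies_rep m \<rho> g u = (\<lambda>i\<in>{..<m}. \<rho> g (u i))"

definition good_index_behaviour ::
  "('g, 'z) monoid_scheme \<Rightarrow> ('g \<Rightarrow> 'k :: field) set \<Rightarrow> ('k, 'u) module \<Rightarrow>
    ('g \<Rightarrow> 'u \<Rightarrow> 'u) \<Rightarrow> bool" where
  "good_index_behaviour Q A U \<rho> \<longleftrightarrow>
     (let q = lie_algebra_of Q A; act = differential Q U \<rho> in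
      \<forall>v\<in>carrier U.
        (let W = orbit_tangent q act v; UW = quotient_space U W in
         ind q (dual U) (dual_act U act) =
         ind (stabiliser q U act v) (dual UW) (dual_act UW (quotient_act U W act))))"

definition differential_kernel ::
  "('g, 'z) monoid_scheme \<Rightarrow> ('g \<Rightarrow> 'k :: field) set \<Rightarrow> ('k, 'u) module \<Rightarrow>
    ('g \<Rightarrow> 'u \<Rightarrow> 'u) \<Rightarrow> ('k, ('g \<Rightarrow> 'k) \<Rightarrow> ('g \<Rightarrow> 'k)) module" where
  "differential_kernel Q A U \<rho> = (lie_algebra_of Q A)
     \<lparr>carrier := {x \<in> carrier (lie_algebra_of Q A).
        \<forall>u\<in>carrier U. differential Q U \<rho> x u = \<zero>\<^bsub>U\<^esub>}\<rparr>"

end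

theory Submission
  imports Defs
begin

text \<open>Put \<open>W = V\<^sup>*\<close>, and let \<open>K\<close> be the kernel of \<open>q\<close> on \<open>W\<close>, which is also its kernel on
  \<open>V\<close>. The index of a module is governed by the smallest stabiliser of a functional. For
  \<open>mV\<^sup>*\<close> and its dual the smallest stabiliser is \<open>K\<close>, attained at a tuple that contains
  a basis. For the slice at \<open>v = (v\<^sub>1, \<dots>, v\<^sub>m)\<close>, choose \<open>I\<close> such that the \<open>v\<^sub>i\<close> with
  \<open>i \<in> I\<close> form a basis of the span of all \<open>v\<^sub>i\<close>. Since \<open>m \<ge> n\<close> there is a tuple \<open>u\<close> that
  vanishes on \<open>I\<close> and whose other entries complete this basis to a generating system of \<open>W\<close>.
  If \<open>x\<close> stabilises \<open>v\<close> and \<open>x \<cdot> u = y \<cdot> v\<close>, then \<open>y\<close> kills \<open>v\<^sub>i\<close> for \<open>i \<in> I\<close>, hence all of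
  \<open>v\<close>; so \<open>x\<close> kills both \<open>v\<close> and \<open>u\<close>, that is, \<open>x \<in> K\<close>. Thus \<open>K\<close> is the stabiliser of the coset
  of \<open>u\<close> in \<open>q\<^sub>v\<close>, and the two indices agree by counting dimensions.\<close>

section \<open>Vector spaces and dual bases\<close>

text \<open>The index sees an action only through ranks: by rank-nullity dim(q . xi) = dim q - dim
  q_xi, so a largest orbit tangent means a smallest stabiliser, and since every stabiliser contains
  \<open>K\<close> it is enough to exhibit one that lies in \<open>K\<close>. For a dual module the
  functionals are evaluations at vectors of the original module, so there the search is for a
  vector, and for a slice it is for a coset. The common value of the indices is nm - (dim q - dim
  K); it is nm - dim q exactly when the differential of rho is injective. The link to the group is
  separate. Since q consists of left-invariant derivations, its finite dimension has to be derived
  from finite generation of k[Q]. The differential of the dual representation has to be computed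
  from that of rho; the sign in the dual action comes from differentiating inversion at the
  identity.\<close>

lemma vectorspace_class_ringI:
  fixes V :: "('k :: field, 'v) module"
  assumes "\<zero>\<^bsub>V\<^esub> \<in> carrier V"
    and "\<And>v w. v \<in> carrier V \<Longrightarrow> w \<in> carrier V \<Longrightarrow> v \<oplus>\<^bsub>V\<^esub> w \<in> carrier V"
    and "\<And>c v. v \<in> carrier V \<Longrightarrow> c \<odot>\<^bsub>V\<^esub> v \<in> carrier V"
    and "\<And>v w. v \<in> carrier V \<Longrightarrow> w \<in> carrier V \<Longrightarrow> v \<oplus>\<^bsub>V\<^esub> w = w \<oplus>\<^bsub>V\<^esub> v"
    and "\<And>u v w. u \<in> carrier V \<Longrightarrow> v \<in> carrier V \<Longrightarrow> w \<in> carrier V \<Longrightarrow>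
      (u \<oplus>\<^bsub>V\<^esub> v) \<oplus>\<^bsub>V\<^esub> w = u \<oplus>\<^bsub>V\<^esub> (v \<oplus>\<^bsub>V\<^esub> w)"
    and "\<And>v. v \<in> carrier V \<Longrightarrow> v \<oplus>\<^bsub>V\<^esub> \<zero>\<^bsub>V\<^esub> = v"
    and "\<And>v. v \<in> carrier V \<Longrightarrow> v \<oplus>\<^bsub>V\<^esub> ((- 1) \<odot>\<^bsub>V\<^esub> v) = \<zero>\<^bsub>V\<^esub>"
    and "\<And>a b v. v \<in> carrier V \<Longrightarrow> (a * b) \<odot>\<^bsub>V\<^esub> v = a \<odot>\<^bsub>V\<^esub> (b \<odot>\<^bsub>V\<^esub> v)"
    and "\<And>v. v \<in> carrier V \<Longrightarrow> 1 \<odot>\<^bsub>V\<^esub> v = v"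
    and "\<And>a b v. v \<in> carrier V \<Longrightarrow> (a + b) \<odot>\<^bsub>V\<^esub> v = a \<odot>\<^bsub>V\<^esub> v \<oplus>\<^bsub>V\<^esub> b \<odot>\<^bsub>V\<^esub> v"
    and "\<And>a v w. v \<in> carrier V \<Longrightarrow> w \<in> carrier V \<Longrightarrow>
      a \<odot>\<^bsub>V\<^esub> (v \<oplus>\<^bsub>V\<^esub> w) = a \<odot>\<^bsub>V\<^esub> v \<oplus>\<^bsub>V\<^esub> a \<odot>\<^bsub>V\<^esub> w"
  shows "vectorspace class_ring V"
proof (rule vs_criteria[OF class_field])
  show "\<forall>v\<in>carrier V. \<exists>w\<in>carrier V. v \<oplus>\<^bsub>V\<^esub> w = \<zero>\<^bsub>V\<^esub>"
    using assms(3,7) by blast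
qed (use assms in auto)

lemma vectorspace_class_ringD:
  fixes V :: "('k :: field, 'v) module"
  assumes "vectorspace class_ring V"
  shows "\<zero>\<^bsub>V\<^esub> \<in> carrier V"
    "\<And>v w. v \<in> carrier V \<Longrightarrow> w \<in> carrier V \<Longrightarrow> v \<oplus>\<^bsub>V\<^esub> w \<in> carrier V"
    "\<And>c v. v \<in> carrier V \<Longrightarrow> c \<odot>\<^bsub>V\<^esub> v \<in> carrier V"
    "\<And>v w. v \<in> carrier V \<Longrightarrow> w \<in> carrier V \<Longrightarrow> v \<oplus>\<^bsub>V\<^esub> w = w \<oplus>\<^bsub>V\<^esub> v"
    "\<And>u v w. u \<in> carrier V \<Longrightarrow> v \<in> carrier V \<Longrightarrow> w \<in> carrier V \<Longrightarrow>
      (u \<oplus>\<^bsub>V\<^esub> v) \<oplus>\<^bsub>V\<^esub> w = u \<oplus>\<^bsub>V\<^esub> (v \<oplus>\<^bsub>V\<^esub> w)"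
    "\<And>v. v \<in> carrier V \<Longrightarrow> v \<oplus>\<^bsub>V\<^esub> \<zero>\<^bsub>V\<^esub> = v"
    "\<And>v. v \<in> carrier V \<Longrightarrow> \<zero>\<^bsub>V\<^esub> \<oplus>\<^bsub>V\<^esub> v = v"
    "\<And>v. v \<in> carrier V \<Longrightarrow> v \<oplus>\<^bsub>V\<^esub> ((- 1) \<odot>\<^bsub>V\<^esub> v) = \<zero>\<^bsub>V\<^esub>"
    "\<And>a b v. v \<in> carrier V \<Longrightarrow> (a * b) \<odot>\<^bsub>V\<^esub> v = a \<odot>\<^bsub>V\<^esub> (b \<odot>\<^bsub>V\<^esub> v)"
    "\<And>v. v \<in> carrier V \<Longrightarrow> 1 \<odot>\<^bsub>V\<^esub> v = v"
    "\<And>a b v. v \<in> carrier V \<Longrightarrow> (a + b) \<odot>\<^bsub>V\<^esub> v = a \<odot>\<^bsub>V\<^esub> v \<oplus>\<^bsub>V\<^esub> b \<odot>\<^bsub>V\<^esub> v"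
    "\<And>a v w. v \<in> carrier V \<Longrightarrow> w \<in> carrier V \<Longrightarrow>
      a \<odot>\<^bsub>V\<^esub> (v \<oplus>\<^bsub>V\<^esub> w) = a \<odot>\<^bsub>V\<^esub> v \<oplus>\<^bsub>V\<^esub> a \<odot>\<^bsub>V\<^esub> w"
    "\<And>c. c \<odot>\<^bsub>V\<^esub> \<zero>\<^bsub>V\<^esub> = \<zero>\<^bsub>V\<^esub>"
    "\<And>v. v \<in> carrier V \<Longrightarrow> 0 \<odot>\<^bsub>V\<^esub> v = \<zero>\<^bsub>V\<^esub>"
proof -
  interpret vectorspace class_ring V by fact
  show "v \<oplus>\<^bsub>V\<^esub> ((- 1) \<odot>\<^bsub>V\<^esub> v) = \<zero>\<^bsub>V\<^esub>" if "v \<in> carrier V" for v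
    using that smult_minus_1[of v] M.r_neg[of v] by (simp add: class_ring_simps)
  show "c \<odot>\<^bsub>V\<^esub> v \<in> carrier V" if "v \<in> carrier V" for c v
    using that smult_closed[of c v] by simp
  show "(u \<oplus>\<^bsub>V\<^esub> v) \<oplus>\<^bsub>V\<^esub> w = u \<oplus>\<^bsub>V\<^esub> (v \<oplus>\<^bsub>V\<^esub> w)"
    if "u \<in> carrier V" "v \<in> carrier V" "w \<in> carrier V" for u v w
    using that by (rule M.a_assoc)
  show "v \<oplus>\<^bsub>V\<^esub> w = w \<oplus>\<^bsub>V\<^esub> v" if "v \<in> carrier V" "w \<in> carrier V" for v w
    using that by (rule M.a_comm)
  show "(a * b) \<odot>\<^bsub>V\<^esub> v = a \<odot>\<^bsub>V\<^esub> (b \<odot>\<^bsub>V\<^esub> v)" if "v \<in> carrier V" for a b v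
    using that smult_assoc1[of a b v] by simp
  show "1 \<odot>\<^bsub>V\<^esub> v = v" if "v \<in> carrier V" for v
    using that smult_one[of v] by simp
  show "(a + b) \<odot>\<^bsub>V\<^esub> v = a \<odot>\<^bsub>V\<^esub> v \<oplus>\<^bsub>V\<^esub> b \<odot>\<^bsub>V\<^esub> v" if "v \<in> carrier V" for a b v
    using that smult_l_distr[of a b v] by simp
  show "a \<odot>\<^bsub>V\<^esub> (v \<oplus>\<^bsub>V\<^esub> w) = a \<odot>\<^bsub>V\<^esub> v \<oplus>\<^bsub>V\<^esub> a \<odot>\<^bsub>V\<^esub> w"
    if "v \<in> carrier V" "w \<in> carrier V" for a v w
    using that smult_r_distr[of a v w] by simp
  show "c \<odot>\<^bsub>V\<^esub> \<zero>\<^bsub>V\<^esub> = \<zero>\<^bsub>V\<^esub>" for c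
    using rmult_0[of c] by simp
  show "0 \<odot>\<^bsub>V\<^esub> v = \<zero>\<^bsub>V\<^esub>" if "v \<in> carrier V" for v
    using that lmult_0[of v] by simp
  show "\<zero>\<^bsub>V\<^esub> \<in> carrier V" by simp
  show "v \<oplus>\<^bsub>V\<^esub> w \<in> carrier V" if "v \<in> carrier V" "w \<in> carrier V" for v w
    using that by simp
  show "v \<oplus>\<^bsub>V\<^esub> \<zero>\<^bsub>V\<^esub> = v" "\<zero>\<^bsub>V\<^esub> \<oplus>\<^bsub>V\<^esub> v = v" if "v \<in> carrier V" for v
    using that by simp_all
qed

lemma linear_map_class_ringI:
  fixes V :: "('k :: field, 'v) module" and W :: "('k, 'w) module"
  assumes "vectorspace class_ring V" "vectorspace class_ring W"
    and "\<And>v. v \<in> carrier V \<Longrightarrow> f v \<in> carrier W"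
    and "\<And>v w. v \<in> carrier V \<Longrightarrow> w \<in> carrier V \<Longrightarrow> f (v \<oplus>\<^bsub>V\<^esub> w) = f v \<oplus>\<^bsub>W\<^esub> f w"
    and "\<And>c v. v \<in> carrier V \<Longrightarrow> f (c \<odot>\<^bsub>V\<^esub> v) = c \<odot>\<^bsub>W\<^esub> f v"
  shows "linear_map class_ring V W f"
  using assms
  by (auto simp: linear_map_def mod_hom_def mod_hom_axioms_def LinearCombinations.module_hom_def vectorspace_def)

lemma subspace_class_ringI:
  fixes V :: "('k :: field, 'v) module"
  assumes "vectorspace class_ring V" "S \<subseteq> carrier V" "\<zero>\<^bsub>V\<^esub> \<in> S"
    and "\<And>v w. v \<in> S \<Longrightarrow> w \<in> S \<Longrightarrow> v \<oplus>\<^bsub>V\<^esub> w \<in> S"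
    and "\<And>c v. v \<in> S \<Longrightarrow> c \<odot>\<^bsub>V\<^esub> v \<in> S"
  shows "subspace class_ring S V"
  using assms by (auto simp: subspace_def submodule_def vectorspace_def)

section \<open>Linear functionals and the dual space\<close>

lemma carrier_dual:
  "carrier (dual V) = {\<phi> \<in> carrier V \<rightarrow>\<^sub>E UNIV.
        (\<forall>v\<in>carrier V. \<forall>w\<in>carrier V. \<phi> (v \<oplus>\<^bsub>V\<^esub> w) = \<phi> v + \<phi> w) \<and>
        (\<forall>c. \<forall>v\<in>carrier V. \<phi> (c \<odot>\<^bsub>V\<^esub> v) = c * \<phi> v)}"
  by (simp add: dual_def)

lemma dual_ops [simp]:
  "\<phi> \<oplus>\<^bsub>dual V\<^esub> \<psi> = (\<lambda>v\<in>carrier V. \<phi> v + \<psi> v)"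
  "c \<odot>\<^bsub>dual V\<^esub> \<phi> = (\<lambda>v\<in>carrier V. c * \<phi> v)"
  "\<zero>\<^bsub>dual V\<^esub> = (\<lambda>v\<in>carrier V. 0)"
  by (simp_all add: dual_def class_ring.func_space_def)

lemma dual_add: "\<phi> \<in> carrier (dual V) \<Longrightarrow> v \<in> carrier V \<Longrightarrow> w \<in> carrier V \<Longrightarrow>
    \<phi> (v \<oplus>\<^bsub>V\<^esub> w) = \<phi> v + \<phi> w"
  and dual_smult: "\<phi> \<in> carrier (dual V) \<Longrightarrow> v \<in> carrier V \<Longrightarrow> \<phi> (c \<odot>\<^bsub>V\<^esub> v) = c * \<phi> v"
  and dual_extensional: "\<phi> \<in> carrier (dual V) \<Longrightarrow> \<phi> \<in> extensional (carrier V)"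
  by (auto simp: carrier_dual PiE_def)

lemma dual_eqI:
  assumes "\<phi> \<in> carrier (dual V)" "\<psi> \<in> carrier (dual V)"
    and "\<And>v. v \<in> carrier V \<Longrightarrow> \<phi> v = \<psi> v"
  shows "\<phi> = \<psi>"
  using assms by (blast intro: extensionalityI dual_extensional)

lemma dual_memI:
  assumes "\<And>v w. v \<in> carrier V \<Longrightarrow> w \<in> carrier V \<Longrightarrow> f (v \<oplus>\<^bsub>V\<^esub> w) = f v + f w"
    and "\<And>c v. v \<in> carrier V \<Longrightarrow> f (c \<odot>\<^bsub>V\<^esub> v) = c * f v"
    and "vectorspace class_ring V"
  shows "(\<lambda>v\<in>carrier V. f v) \<in> carrier (dual V)"
proof -
  interpret vectorspace class_ring V by fact
  have "c \<odot>\<^bsub>V\<^esub> v \<in> carrier V" if "v \<in> carrier V" for c v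
    using that smult_closed[of c v] by simp
  then show ?thesis
    using assms by (auto simp: carrier_dual)
qed

lemma vectorspace_smult_closed:
  assumes "vectorspace class_ring V" "v \<in> carrier V"
  shows "c \<odot>\<^bsub>V\<^esub> v \<in> carrier V"
proof -
  interpret vectorspace class_ring V by fact
  show ?thesis using assms smult_closed[of c v] by simp
qed

lemma vectorspace_dual:
  assumes "vectorspace class_ring V"
  shows "vectorspace class_ring (dual V)"
proof -
  interpret vectorspace class_ring V by fact
  note [simp] = vectorspace_smult_closed[OF assms]
  show ?thesis
    by (rule vectorspace_class_ringI)
      (auto simp: carrier_dual algebra_simps fun_eq_iff PiE_def extensional_def)
qed

lemma dual_zero_arg:
  assumes "vectorspace class_ring V" "\<phi> \<in> carrier (dual V)"
  shows "\<phi> \<zero>\<^bsub>V\<^esub> = 0"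
proof -
  interpret vectorspace class_ring V by fact
  have "\<phi> \<zero>\<^bsub>V\<^esub> = \<phi> \<zero>\<^bsub>V\<^esub> + \<phi> \<zero>\<^bsub>V\<^esub>"
    using dual_add[OF assms(2), of "\<zero>\<^bsub>V\<^esub>" "\<zero>\<^bsub>V\<^esub>"] by simp
  then show ?thesis by (metis add_cancel_right_right)
qed

lemma dual_lincomb:
  assumes "vectorspace class_ring V" "\<phi> \<in> carrier (dual V)" "finite X" "X \<subseteq> carrier V"
  shows "\<phi> (module.lincomb V a X) = (\<Sum>x\<in>X. a x * \<phi> x)"
proof -
  interpret vectorspace class_ring V by fact
  show ?thesis
    using assms(3,4)
  proof induction
    case empty
    then show ?case using assms(1,2) by (simp add: dual_zero_arg)
  next
    case (insert x X)
    have "lincomb a (insert x X) = a x \<odot>\<^bsub>V\<^esub> x \<oplus>\<^bsub>V\<^esub> lincomb a X"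
      using insert by (intro lincomb_insert2) auto
    moreover have "lincomb a X \<in> carrier V"
      using insert by (intro lincomb_closed) auto
    ultimately show ?case
      using insert assms by (simp add: dual_add dual_smult vectorspace_smult_closed)
  qed
qed

lemma dual_neg:
  assumes "vectorspace class_ring V" "\<phi> \<in> carrier (dual V)" "v \<in> carrier V"
  shows "\<phi> (\<ominus>\<^bsub>V\<^esub> v) = - \<phi> v"
proof -
  interpret vectorspace class_ring V by fact
  have "\<phi> (v \<oplus>\<^bsub>V\<^esub> \<ominus>\<^bsub>V\<^esub> v) = \<phi> v + \<phi> (\<ominus>\<^bsub>V\<^esub> v)"
    using assms by (intro dual_add) auto
  then have "\<phi> v + \<phi> (\<ominus>\<^bsub>V\<^esub> v) = 0"
    using assms by (simp add: M.r_neg dual_zero_arg)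
  then show ?thesis
    by (metis add.inverse_unique)
qed

lemma dual_minus:
  assumes "vectorspace class_ring V" "\<phi> \<in> carrier (dual V)" "v \<in> carrier V" "w \<in> carrier V"
  shows "\<phi> (v \<ominus>\<^bsub>V\<^esub> w) = \<phi> v - \<phi> w"
proof -
  interpret vectorspace class_ring V by fact
  show ?thesis
    using assms by (simp add: a_minus_def dual_add dual_neg)
qed

text \<open>Equality is tested on the difference. Any separating set \<open>S\<close> is allowed,
  because the coordinate functionals of a dual system must serve here before finite dimension is
  available.\<close>

lemma separating_eqI:
  assumes "vectorspace class_ring V" "S \<subseteq> carrier (dual V)"
    and "\<And>v. v \<in> carrier V \<Longrightarrow> (\<And>\<phi>. \<phi> \<in> S \<Longrightarrow> \<phi> v = 0) \<Longrightarrow> v = \<zero>\<^bsub>V\<^esub>"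
    and "v \<in> carrier V" "w \<in> carrier V" "\<And>\<phi>. \<phi> \<in> S \<Longrightarrow> \<phi> v = \<phi> w"
  shows "v = w"
proof -
  interpret vectorspace class_ring V by fact
  have "\<phi> (v \<ominus>\<^bsub>V\<^esub> w) = 0" if "\<phi> \<in> S" for \<phi>
    using dual_minus[OF assms(1), of \<phi> v w] assms(2,4-6) that by auto
  then have "v \<ominus>\<^bsub>V\<^esub> w = \<zero>\<^bsub>V\<^esub>"
    using assms(4,5) by (intro assms(3)) auto
  then show ?thesis
    using M.minus_other_side[OF assms(4,5)] by blast
qed

text \<open>A basis together with its coordinate functionals: biorthogonality gives independence,
  and the requirement that the \<open>c i\<close> separate points stands in for spanning. Both are
  pointwise checks, and the free index type lets pairs, vectors or functionals index a
  basis.\<close>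

definition dual_system :: "('k :: field, 'v) module \<Rightarrow> 'i set \<Rightarrow> ('i \<Rightarrow> 'v) \<Rightarrow> ('i \<Rightarrow> 'v \<Rightarrow> 'k) \<Rightarrow> bool"
  where "dual_system V I e c \<longleftrightarrow> finite I \<and> e \<in> I \<rightarrow> carrier V \<and> c \<in> I \<rightarrow> carrier (dual V) \<and>
    (\<forall>i\<in>I. \<forall>j\<in>I. c i (e j) = (if i = j then 1 else 0)) \<and>
    (\<forall>v\<in>carrier V. (\<forall>i\<in>I. c i v = 0) \<longrightarrow> v = \<zero>\<^bsub>V\<^esub>)"

text \<open>A vector and its expansion have the same coordinates, hence agree because the
  \<open>c i\<close> separate; applying \<open>c i\<close> to a linear relation isolates one
  coefficient. The coefficients go through \<open>inv_into\<close> because \<open>lincomb\<close> is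
  indexed by vectors and not by \<open>I\<close>.\<close>

lemma dual_system_basis:
  assumes V: "vectorspace class_ring V" and ds: "dual_system V I e c"
  shows "vectorspace.basis class_ring V (e ` I)" "inj_on e I"
    "\<And>v. v \<in> carrier V \<Longrightarrow> v = module.lincomb V (\<lambda>x. c (inv_into I e x) v) (e ` I)"
proof -
  interpret vectorspace class_ring V by fact
  have fin: "finite I" and e: "\<And>i. i \<in> I \<Longrightarrow> e i \<in> carrier V"
    and c: "\<And>i. i \<in> I \<Longrightarrow> c i \<in> carrier (dual V)"
    and ce: "\<And>i j. i \<in> I \<Longrightarrow> j \<in> I \<Longrightarrow> c i (e j) = (if i = j then 1 else 0)"
    and sep: "\<And>v. v \<in> carrier V \<Longrightarrow> (\<And>i. i \<in> I \<Longrightarrow> c i v = 0) \<Longrightarrow> v = \<zero>\<^bsub>V\<^esub>"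
    using ds by (auto simp: dual_system_def)
  show inj: "inj_on e I"
  proof (rule inj_onI)
    fix i j assume ij: "i \<in> I" "j \<in> I" "e i = e j"
    then have "c i (e j) = 1" using ce[of i i] by simp
    then show "i = j" using ce[OF ij(1,2)] by (auto split: if_splits)
  qed
  have sub: "e ` I \<subseteq> carrier V" using e by auto
  have coeff: "c i (lincomb a (e ` I)) = a (e i)" if "i \<in> I" for a i
  proof -
    have "c i (lincomb a (e ` I)) = (\<Sum>j\<in>I. a (e j) * c i (e j))"
      using that fin sub inj by (simp add: dual_lincomb[OF V c] sum.reindex)
    also have "\<dots> = (\<Sum>j\<in>I. if j = i then a (e j) else 0)"
      using that by (intro sum.cong) (auto simp: ce)
    finally show ?thesis using that fin by simp
  qed
  have lc: "lincomb a (e ` I) \<in> carrier V" for a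
    using sub by (intro lincomb_closed) auto
  show expand: "v = lincomb (\<lambda>x. c (inv_into I e x) v) (e ` I)" if "v \<in> carrier V" for v
  proof (rule separating_eqI[OF V, of "c ` I"])
    show "v = \<zero>\<^bsub>V\<^esub>" if "v \<in> carrier V" "\<And>\<phi>. \<phi> \<in> c ` I \<Longrightarrow> \<phi> v = 0" for v
      using sep that by blast
  qed (use c that lc inj coeff in auto)
  have "lin_indpt (e ` I)"
  proof (rule finite_lin_indpt2)
    fix a assume "lincomb a (e ` I) = \<zero>\<^bsub>V\<^esub>"
    then have "a (e i) = 0" if "i \<in> I" for i
      using coeff[OF that, of a] dual_zero_arg[OF V c[OF that]] by simp
    then show "\<forall>v\<in>e ` I. a v = \<zero>\<^bsub>class_ring\<^esub>" by simp
  qed (use fin sub in auto)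
  moreover have "gen_set (e ` I)"
  proof
    show "span (e ` I) \<subseteq> carrier V" using sub by (rule span_is_subset2)
    have "v \<in> span (e ` I)" if "v \<in> carrier V" for v
      using expand[OF that] fin by (auto simp: span_def)
    then show "carrier V \<subseteq> span (e ` I)" by blast
  qed
  ultimately show "basis (e ` I)"
    using sub by (simp add: basis_def)
qed

lemma dual_system_fin_dim:
  assumes "vectorspace class_ring V" "dual_system V I e c"
  shows "vectorspace.fin_dim class_ring V" "vdim V = card I"
proof -
  interpret vectorspace class_ring V by fact
  note b = dual_system_basis[OF assms]
  have fin: "finite I" using assms(2) by (simp add: dual_system_def)
  show fin_dim
    unfolding fin_dim_def
  proof (intro exI conjI)
    show "finite (e ` I)" using fin by simp
    show "e ` I \<subseteq> carrier V" "gen_set (e ` I)" using b(1) by (simp_all add: basis_def)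
  qed
  show "dim = card I"
    using dim_basis[OF _ b(1)] fin b(2) by (simp add: card_image)
qed

lemma dual_system_expand:
  assumes "vectorspace class_ring V" "dual_system V I e c" "\<phi> \<in> carrier (dual V)" "v \<in> carrier V"
  shows "\<phi> v = (\<Sum>i\<in>I. c i v * \<phi> (e i))"
proof -
  have fin: "finite I" and e: "e ` I \<subseteq> carrier V"
    using assms(2) by (auto simp: dual_system_def)
  note b = dual_system_basis[OF assms(1,2)]
  have "\<phi> v = \<phi> (module.lincomb V (\<lambda>x. c (inv_into I e x) v) (e ` I))"
    using b(3)[OF assms(4)] by simp
  also have "\<dots> = (\<Sum>i\<in>I. c i v * \<phi> (e i))"
    using fin e b(2) by (simp add: dual_lincomb[OF assms(1,3)] sum.reindex)
  finally show ?thesis .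
qed

text \<open>Coordinates with respect to a basis \<open>X\<close> are linear because coefficients are
  unique. Each basis vector serves as its own index.\<close>

lemma dual_system_exists:
  assumes V: "vectorspace class_ring V" and "vectorspace.fin_dim class_ring V"
  shows "\<exists>X c. dual_system V X (\<lambda>x. x) c"
proof -
  interpret vectorspace class_ring V by fact
  obtain X where X: "finite X" "basis X"
    using finite_basis_exists assms(2) by blast
  then have sub: "X \<subseteq> carrier V" by (simp add: basis_def)
  define a where "a v = (THE a. a \<in> X \<rightarrow>\<^sub>E carrier class_ring \<and> lincomb a X = v)" for v
  have ex1: "\<exists>!a. a \<in> X \<rightarrow>\<^sub>E carrier class_ring \<and> lincomb a X = v" if "v \<in> carrier V" for v
    using basis_criterion[OF X(1) sub] X(2) that by blast
  have a: "lincomb (a v) X = v" if "v \<in> carrier V" for v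
    using theI'[OF ex1[OF that]] by (simp add: a_def)
  \<comment> \<open>The definite description ranges over extensional coefficient functions, so
    \<open>b\<close> is restricted to \<open>X\<close> before it is compared.\<close>
  have uniq: "a v x = b x" if "lincomb b X = v" "x \<in> X" for b v x
  proof -
    have "lincomb (restrict b X) X = lincomb b X"
      using sub by (intro lincomb_cong) auto
    moreover have "lincomb b X \<in> carrier V"
      using sub by (intro lincomb_closed) auto
    ultimately have "a v = restrict b X"
      using ex1[of v] that(1) unfolding a_def
      by (intro the1_equality) auto
    then show ?thesis using that by simp
  qed
  have ein: "(\<lambda>v\<in>carrier V. a v x) \<in> carrier (dual V)" if x: "x \<in> X" for x
  proof (rule dual_memI)
    fix v w assume vw: "v \<in> carrier V" "w \<in> carrier V"
    have "lincomb (\<lambda>x. a v x + a w x) X = v \<oplus>\<^bsub>V\<^esub> w"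
      using lincomb_sum[OF X(1) sub, of "a v" "a w"] a vw by simp
    then show "a (v \<oplus>\<^bsub>V\<^esub> w) x = a v x + a w x"
      using uniq x by blast
  next
    fix k v assume v: "v \<in> carrier V"
    have "lincomb (\<lambda>x. k * a v x) X = k \<odot>\<^bsub>V\<^esub> v"
      using lincomb_smult[OF sub, of "a v" k] a v by simp
    then show "a (k \<odot>\<^bsub>V\<^esub> v) x = k * a v x"
      using uniq x by blast
  qed fact
  have "dual_system V X (\<lambda>x. x) (\<lambda>x. \<lambda>v\<in>carrier V. a v x)"
    unfolding dual_system_def
  proof (intro conjI ballI impI)
    fix x y assume xy: "x \<in> X" "y \<in> X"
    have y: "y \<in> carrier V" using xy sub by blast
    \<comment> \<open>The Kronecker delta at \<open>y\<close> represents \<open>y\<close>;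
      uniqueness then reads off its coordinates.\<close>
    have "lincomb (\<lambda>z. if z = y then 1 else 0) (X - {y}) = \<zero>\<^bsub>V\<^esub>"
      using sub by (intro lincomb_zero) auto
    then have "lincomb (\<lambda>z. if z = y then 1 else 0) X = 1 \<odot>\<^bsub>V\<^esub> y \<oplus>\<^bsub>V\<^esub> \<zero>\<^bsub>V\<^esub>"
      using lincomb_del2[OF X(1) sub _ xy(2), of "\<lambda>z. if z = y then 1 else 0"] by simp
    also have "\<dots> = y" using smult_one[OF y] y by simp
    finally have "lincomb (\<lambda>z. if z = y then 1 else 0) X = y" .
    then have "a y x = (if x = y then 1 else 0)"
      using uniq[of "\<lambda>z. if z = y then 1 else 0" y x] xy by simp
    then show "(\<lambda>v\<in>carrier V. a v x) y = (if x = y then 1 else 0)"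
      using xy sub by auto
  next
    fix v assume v: "v \<in> carrier V" "\<forall>x\<in>X. (\<lambda>v\<in>carrier V. a v x) v = 0"
    have "lincomb (a v) X = \<zero>\<^bsub>V\<^esub>"
      using v by (intro lincomb_zero[OF sub]) auto
    then show "v = \<zero>\<^bsub>V\<^esub>" using a v by simp
  qed (use X sub ein in auto)
  then show ?thesis by blast
qed

section \<open>Finite-dimensional spaces: reflexivity, separating sets, rank\<close>

definition fdvs :: "('k :: field, 'v) module \<Rightarrow> bool"
  where "fdvs V \<longleftrightarrow> vectorspace class_ring V \<and> vectorspace.fin_dim class_ring V"

lemma fdvs_dual_system:
  assumes "fdvs V"
  obtains X c where "dual_system V X (\<lambda>x. x) c" "card X = vdim V"
  using assms dual_system_exists[of V] dual_system_fin_dim[of V]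
  unfolding fdvs_def by metis

lemma fdvsI:
  assumes "vectorspace class_ring V" "dual_system V I e c"
  shows "fdvs V"
  using assms dual_system_fin_dim unfolding fdvs_def by blast

lemma evaluation_mem_dual:
  assumes "vectorspace class_ring V" "v \<in> carrier V"
  shows "(\<lambda>\<phi>\<in>carrier (dual V). \<phi> v) \<in> carrier (dual (dual V))"
  using assms by (intro dual_memI vectorspace_dual) auto

text \<open>The two halves swap roles: the \<open>c i\<close> become the basis and evaluations at
  the \<open>e i\<close> the coordinates. A functional that vanishes on all \<open>e i\<close> is
  zero by the expansion formula.\<close>

lemma dual_system_dual:
  assumes V: "vectorspace class_ring V" and ds: "dual_system V I e c"
  shows "dual_system (dual V) I c (\<lambda>i. \<lambda>\<phi>\<in>carrier (dual V). \<phi> (e i))"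
  unfolding dual_system_def
proof (intro conjI ballI impI)
  show "(\<lambda>i. \<lambda>\<phi>\<in>carrier (dual V). \<phi> (e i)) \<in> I \<rightarrow> carrier (dual (dual V))"
    using ds evaluation_mem_dual[OF V] by (auto simp: dual_system_def)
next
  fix \<phi> assume \<phi>: "\<phi> \<in> carrier (dual V)" "\<forall>i\<in>I. (\<lambda>\<phi>\<in>carrier (dual V). \<phi> (e i)) \<phi> = 0"
  interpret D: vectorspace class_ring "dual V" using V by (rule vectorspace_dual)
  show "\<phi> = \<zero>\<^bsub>dual V\<^esub>"
  proof (rule dual_eqI)
    fix v assume v: "v \<in> carrier V"
    then show "\<phi> v = \<zero>\<^bsub>dual V\<^esub> v"
      using dual_system_expand[OF V ds \<phi>(1) v] \<phi> by simp
  qed (use \<phi> in \<open>simp_all only: D.M.zero_closed\<close>)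
qed (use ds in \<open>auto simp: dual_system_def\<close>)

lemma fdvs_dual:
  assumes "fdvs V"
  shows "fdvs (dual V)" "vdim (dual V) = vdim V"
proof -
  have V: "vectorspace class_ring V" using assms by (simp add: fdvs_def)
  obtain X c where ds: "dual_system V X (\<lambda>x. x) c" "card X = vdim V"
    using assms by (rule fdvs_dual_system)
  note ds' = dual_system_dual[OF V ds(1)]
  show "fdvs (dual V)" "vdim (dual V) = vdim V"
    using fdvsI[OF vectorspace_dual[OF V] ds'] dual_system_fin_dim(2)[OF vectorspace_dual[OF V] ds']
      ds(2) by simp_all
qed

lemma dual_separates:
  assumes "fdvs V" "v \<in> carrier V" "\<And>\<phi>. \<phi> \<in> carrier (dual V) \<Longrightarrow> \<phi> v = 0"
  shows "v = \<zero>\<^bsub>V\<^esub>"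
proof -
  obtain X c where "dual_system V X (\<lambda>x. x) c" "card X = vdim V"
    using assms(1) by (rule fdvs_dual_system)
  then show ?thesis using assms(2,3) unfolding dual_system_def by blast
qed

lemma dual_separates_eq:
  assumes "fdvs V" "v \<in> carrier V" "w \<in> carrier V" "\<And>\<phi>. \<phi> \<in> carrier (dual V) \<Longrightarrow> \<phi> v = \<phi> w"
  shows "v = w"
  using assms dual_separates[OF assms(1)]
  by (intro separating_eqI[of V "carrier (dual V)" v w]) (auto simp: fdvs_def)

text \<open>The representing vector has the coordinates \<open>\<Phi> (c x)\<close>; expanding
  \<open>\<phi>\<close> in the dual basis shows that it works.\<close>

lemma double_dual:
  assumes "fdvs V" "\<Phi> \<in> carrier (dual (dual V))"
  obtains v where "v \<in> carrier V" "\<forall>\<phi>\<in>carrier (dual V). \<Phi> \<phi> = \<phi> v"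
proof -
  have V: "vectorspace class_ring V" using assms by (simp add: fdvs_def)
  then interpret vectorspace class_ring V .
  obtain X c where ds: "dual_system V X (\<lambda>x. x) c" "card X = vdim V"
    using assms(1) by (rule fdvs_dual_system)
  then have X: "finite X" "X \<subseteq> carrier V" by (auto simp: dual_system_def)
  show thesis
  proof
    show "lincomb (\<lambda>x. \<Phi> (c x)) X \<in> carrier V"
      using X by (intro lincomb_closed) auto
    show "\<forall>\<phi>\<in>carrier (dual V). \<Phi> \<phi> = \<phi> (lincomb (\<lambda>x. \<Phi> (c x)) X)"
    proof
      fix \<phi> assume \<phi>: "\<phi> \<in> carrier (dual V)"
      show "\<Phi> \<phi> = \<phi> (lincomb (\<lambda>x. \<Phi> (c x)) X)"
        using dual_system_expand[OF vectorspace_dual[OF V] dual_system_dual[OF V ds(1)] assms(2) \<phi>] \<phi>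
        by (simp add: dual_lincomb[OF V \<phi> X] mult.commute)
    qed
  qed
qed

text \<open>A minimal separating set of functionals is, after rescaling, half of a dual system.\<close>
lemma fdvs_if_separating:
  assumes V: "vectorspace class_ring V" and "finite S" "S \<subseteq> carrier (dual V)"
    and "\<And>v. v \<in> carrier V \<Longrightarrow> (\<And>\<phi>. \<phi> \<in> S \<Longrightarrow> \<phi> v = 0) \<Longrightarrow> v = \<zero>\<^bsub>V\<^esub>"
  shows "fdvs V"
proof -
  define sep where "sep T \<longleftrightarrow> (\<forall>v\<in>carrier V. (\<forall>\<phi>\<in>T. \<phi> v = 0) \<longrightarrow> v = \<zero>\<^bsub>V\<^esub>)"
    for T :: "('b \<Rightarrow> 'a) set"
  have "S \<subseteq> S \<and> sep S" unfolding sep_def using assms(4) by blast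
  from ex_has_least_nat[of "\<lambda>T. T \<subseteq> S \<and> sep T", OF this, of card]
  obtain T where T: "T \<subseteq> S" "sep T" and min: "\<And>T'. T' \<subseteq> S \<Longrightarrow> sep T' \<Longrightarrow> card T \<le> card T'"
    by blast
  have fin: "finite T" using T(1) assms(2) by (rule finite_subset)
  \<comment> \<open>Without \<open>\<phi>\<close> the set no longer separates, so some nonzero
    vector is killed by all the others; \<open>\<phi>\<close> cannot kill it too.\<close>
  have "\<exists>v\<in>carrier V. \<phi> v = 1 \<and> (\<forall>\<psi>\<in>T - {\<phi>}. \<psi> v = 0)" if \<phi>: "\<phi> \<in> T" for \<phi>
  proof -
    have "card (T - {\<phi>}) < card T" using fin \<phi> by (rule card_Diff1_less)
    moreover have "T - {\<phi>} \<subseteq> S" using T(1) by blast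
    ultimately have "\<not> sep (T - {\<phi>})" using min[of "T - {\<phi>}"] by linarith
    then obtain v where v: "v \<in> carrier V" "\<forall>\<psi>\<in>T - {\<phi>}. \<psi> v = 0" "v \<noteq> \<zero>\<^bsub>V\<^esub>"
      unfolding sep_def by blast
    have "\<phi> v \<noteq> 0"
    proof
      assume "\<phi> v = 0"
      then have "\<forall>\<psi>\<in>T. \<psi> v = 0" using v(2) by blast
      then show False using v(1,3) T(2) unfolding sep_def by blast
    qed
    have smult: "\<psi> (inverse (\<phi> v) \<odot>\<^bsub>V\<^esub> v) = inverse (\<phi> v) * \<psi> v" if "\<psi> \<in> T" for \<psi>
      using that T(1) assms(3) v(1) by (intro dual_smult) blast+
    show ?thesis
    proof (intro bexI conjI ballI)
      show "\<phi> (inverse (\<phi> v) \<odot>\<^bsub>V\<^esub> v) = 1" using smult[OF \<phi>] \<open>\<phi> v \<noteq> 0\<close> by simp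
      show "\<psi> (inverse (\<phi> v) \<odot>\<^bsub>V\<^esub> v) = 0" if "\<psi> \<in> T - {\<phi>}" for \<psi>
        using smult[of \<psi>] that v(2) by simp
    qed (rule vectorspace_smult_closed[OF V v(1)])
  qed
  then obtain e where e: "\<And>\<phi>. \<phi> \<in> T \<Longrightarrow> e \<phi> \<in> carrier V \<and> \<phi> (e \<phi>) = 1 \<and> (\<forall>\<psi>\<in>T - {\<phi>}. \<psi> (e \<phi>) = 0)"
    by metis
  have "dual_system V T e (\<lambda>\<phi>. \<phi>)"
    unfolding dual_system_def
  proof (intro conjI)
    show "\<forall>v\<in>carrier V. (\<forall>i\<in>T. i v = 0) \<longrightarrow> v = \<zero>\<^bsub>V\<^esub>"
      using T(2) by (simp add: sep_def)
    show "\<forall>\<phi>\<in>T. \<forall>\<psi>\<in>T. \<phi> (e \<psi>) = (if \<phi> = \<psi> then 1 else 0)"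
      using e by auto
    show "e \<in> T \<rightarrow> carrier V" using e by blast
    show "(\<lambda>\<phi>. \<phi>) \<in> T \<rightarrow> carrier (dual V)" using T(1) assms(3) by blast
  qed (rule fin)
  then show ?thesis using V by (rule fdvsI[rotated])
qed

text \<open>The coordinate functionals of \<open>V\<close> still separate the points of
  \<open>S\<close>. They are restricted because members of a dual are extensional on the
  carrier.\<close>

lemma fdvs_subspace:
  assumes "fdvs V" "subspace class_ring S V"
  shows "fdvs (V\<lparr>carrier := S\<rparr>)"
proof -
  have V: "vectorspace class_ring V" using assms by (simp add: fdvs_def)
  interpret vectorspace class_ring V by fact
  have S: "S \<subseteq> carrier V" "\<And>v w. v \<in> S \<Longrightarrow> w \<in> S \<Longrightarrow> v \<oplus>\<^bsub>V\<^esub> w \<in> S"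
    "\<And>c v. v \<in> S \<Longrightarrow> c \<odot>\<^bsub>V\<^esub> v \<in> S"
    using assms(2) by (auto simp: subspace_def submodule_def)
  obtain X c where ds: "dual_system V X (\<lambda>x. x) c" "card X = vdim V"
    using assms(1) by (rule fdvs_dual_system)
  then have c: "finite X" "\<And>x. x \<in> X \<Longrightarrow> c x \<in> carrier (dual V)"
    "\<And>v. v \<in> carrier V \<Longrightarrow> (\<And>x. x \<in> X \<Longrightarrow> c x v = 0) \<Longrightarrow> v = \<zero>\<^bsub>V\<^esub>"
    by (auto simp: dual_system_def)
  show ?thesis
  proof (rule fdvs_if_separating[where S = "(\<lambda>x. restrict (c x) S) ` X"])
    show "vectorspace class_ring (V\<lparr>carrier := S\<rparr>)"
      using assms(2) by (rule subspace_is_vs)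
    show "(\<lambda>x. restrict (c x) S) ` X \<subseteq> carrier (dual (V\<lparr>carrier := S\<rparr>))"
      using c(2) S by (auto simp: carrier_dual subset_iff)
    show "v = \<zero>\<^bsub>V\<lparr>carrier := S\<rparr>\<^esub>" if *: "v \<in> carrier (V\<lparr>carrier := S\<rparr>)"
      "\<And>\<phi>. \<phi> \<in> (\<lambda>x. restrict (c x) S) ` X \<Longrightarrow> \<phi> v = 0" for v
    proof -
      have "c x v = 0" if "x \<in> X" for x
        using *(2)[of "restrict (c x) S"] *(1) that by simp
      then have "v = \<zero>\<^bsub>V\<^esub>" using S(1) *(1) by (intro c(3)) auto
      then show ?thesis by simp
    qed
  qed (use c in auto)
qed

text \<open>Linear independence does not depend on the ambient subspace, so a basis of
  \<open>S\<close> stays independent in \<open>T\<close>.\<close>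

lemma vdim_subspace_mono:
  assumes V: "fdvs V" and S: "subspace class_ring S V" and T: "subspace class_ring T V" and "S \<subseteq> T"
  shows "vdim (V\<lparr>carrier := S\<rparr>) \<le> vdim (V\<lparr>carrier := T\<rparr>)"
proof -
  interpret vectorspace class_ring V using V by (simp add: fdvs_def)
  interpret S: vectorspace class_ring "V\<lparr>carrier := S\<rparr>" using S by (rule subspace_is_vs)
  interpret T: vectorspace class_ring "V\<lparr>carrier := T\<rparr>" using T by (rule subspace_is_vs)
  obtain B where B: "finite B" "S.basis B"
    using S.finite_basis_exists fdvs_subspace[OF V S] unfolding fdvs_def by blast
  then have BS: "B \<subseteq> S" by (simp add: S.basis_def)
  have "T.lin_indpt B"
    using B(2) BS span_li_not_depend(2)[of B S] span_li_not_depend(2)[of B T] S T \<open>S \<subseteq> T\<close>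
    unfolding S.basis_def subspace_def by blast
  moreover have "B \<subseteq> carrier (V\<lparr>carrier := T\<rparr>)" using BS \<open>S \<subseteq> T\<close> by simp
  ultimately have "card B \<le> T.dim"
    using T.li_le_dim(2)[of B] fdvs_subspace[OF V T] unfolding fdvs_def by blast
  then show ?thesis using S.dim_basis[OF B] by simp
qed

lemma rank_nullity_fdvs:
  assumes "fdvs V" "linear_map class_ring V W f"
  shows "vdim (W\<lparr>carrier := f ` carrier V\<rparr>) +
    vdim (V\<lparr>carrier := {v \<in> carrier V. f v = \<zero>\<^bsub>W\<^esub>}\<rparr>) = vdim V"
proof -
  interpret linear_map class_ring V W f by fact
  show ?thesis
    using rank_nullity assms(1) by (simp add: fdvs_def im_def ker_def)
qed

lemma linear_map_kernel_subspace:
  assumes "linear_map class_ring V W f"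
  shows "subspace class_ring {v \<in> carrier V. f v = \<zero>\<^bsub>W\<^esub>} V"
proof -
  interpret linear_map class_ring V W f by fact
  show ?thesis using kerT_is_subspace by (simp add: ker_def)
qed

section \<open>Linear actions and their index\<close>

text \<open>Just bilinearity, so that one notion covers \<open>q\<close>, a subspace such as
  \<open>q_v\<close>, and dual or quotient modules. The bracket enters through
  \<open>copies_action\<close>.\<close>

definition linear_action :: "('k :: field, 'q) module \<Rightarrow> ('k, 'u) module \<Rightarrow> ('q \<Rightarrow> 'u \<Rightarrow> 'u) \<Rightarrow> bool"
  where "linear_action q U act \<longleftrightarrow> fdvs q \<and> fdvs U \<and>
    (\<forall>x\<in>carrier q. \<forall>u\<in>carrier U. act x u \<in> carrier U) \<and>
    (\<forall>x\<in>carrier q. \<forall>u\<in>carrier U. \<forall>w\<in>carrier U. act x (u \<oplus>\<^bsub>U\<^esub> w) = act x u \<oplus>\<^bsub>U\<^esub> act x w) \<and>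
    (\<forall>x\<in>carrier q. \<forall>c. \<forall>u\<in>carrier U. act x (c \<odot>\<^bsub>U\<^esub> u) = c \<odot>\<^bsub>U\<^esub> act x u) \<and>
    (\<forall>x\<in>carrier q. \<forall>y\<in>carrier q. \<forall>u\<in>carrier U. act (x \<oplus>\<^bsub>q\<^esub> y) u = act x u \<oplus>\<^bsub>U\<^esub> act y u) \<and>
    (\<forall>c. \<forall>x\<in>carrier q. \<forall>u\<in>carrier U. act (c \<odot>\<^bsub>q\<^esub> x) u = c \<odot>\<^bsub>U\<^esub> act x u)"

lemma linear_actionD:
  assumes "linear_action q U act"
  shows "fdvs q" "fdvs U" "vectorspace class_ring q" "vectorspace class_ring U"
    "\<And>x u. x \<in> carrier q \<Longrightarrow> u \<in> carrier U \<Longrightarrow> act x u \<in> carrier U"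
    "\<And>x u w. x \<in> carrier q \<Longrightarrow> u \<in> carrier U \<Longrightarrow> w \<in> carrier U \<Longrightarrow>
      act x (u \<oplus>\<^bsub>U\<^esub> w) = act x u \<oplus>\<^bsub>U\<^esub> act x w"
    "\<And>x c u. x \<in> carrier q \<Longrightarrow> u \<in> carrier U \<Longrightarrow> act x (c \<odot>\<^bsub>U\<^esub> u) = c \<odot>\<^bsub>U\<^esub> act x u"
    "\<And>x y u. x \<in> carrier q \<Longrightarrow> y \<in> carrier q \<Longrightarrow> u \<in> carrier U \<Longrightarrow>
      act (x \<oplus>\<^bsub>q\<^esub> y) u = act x u \<oplus>\<^bsub>U\<^esub> act y u"
    "\<And>c x u. x \<in> carrier q \<Longrightarrow> u \<in> carrier U \<Longrightarrow> act (c \<odot>\<^bsub>q\<^esub> x) u = c \<odot>\<^bsub>U\<^esub> act x u"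
  using assms by (simp_all add: linear_action_def fdvs_def)

lemma linear_action_orbit_map:
  assumes "linear_action q U act" "u \<in> carrier U"
  shows "linear_map class_ring q U (\<lambda>x. act x u)"
  using linear_actionD[OF assms(1)] assms(2) by (intro linear_map_class_ringI) auto

lemma linear_action_map:
  assumes "linear_action q U act" "x \<in> carrier q"
  shows "linear_map class_ring U U (act x)"
  using linear_actionD[OF assms(1)] assms(2) by (intro linear_map_class_ringI) auto

lemma linear_action_zero:
  assumes "linear_action q U act" "x \<in> carrier q"
  shows "act x \<zero>\<^bsub>U\<^esub> = \<zero>\<^bsub>U\<^esub>"
proof -
  interpret linear_map class_ring U U "act x" using assms by (rule linear_action_map)
  show ?thesis by (rule f0_is_0)
qed

lemma linear_action_subspace:
  assumes "linear_action q U act" "subspace class_ring H q"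
  shows "linear_action (q\<lparr>carrier := H\<rparr>) U act"
proof -
  have "H \<subseteq> carrier q" using assms(2) by (auto simp: subspace_def submodule_def)
  then show ?thesis
    using linear_actionD[OF assms(1)] fdvs_subspace[of q H] assms(2)
    by (auto simp: linear_action_def subset_iff)
qed

lemma linear_action_dual:
  assumes "linear_action q U act"
  shows "linear_action q (dual U) (dual_act U act)"
proof -
  note D = linear_actionD[OF assms]
  interpret vectorspace class_ring U by (fact D)
  note [simp] = vectorspace_smult_closed[OF D(4)]
  have closed: "dual_act U act x \<xi> \<in> carrier (dual U)" if "x \<in> carrier q" "\<xi> \<in> carrier (dual U)" for x \<xi>
    unfolding dual_act_def using that D
    by (intro dual_memI) (auto simp: dual_add dual_smult)
  have "dual_act U act x (\<xi> \<oplus>\<^bsub>dual U\<^esub> \<eta>) = dual_act U act x \<xi> \<oplus>\<^bsub>dual U\<^esub> dual_act U act x \<eta>"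
    if "x \<in> carrier q" for x \<xi> \<eta>
    using that D(5) by (auto simp: dual_act_def fun_eq_iff)
  moreover have "dual_act U act x (c \<odot>\<^bsub>dual U\<^esub> \<xi>) = c \<odot>\<^bsub>dual U\<^esub> dual_act U act x \<xi>"
    if "x \<in> carrier q" for x c \<xi>
    using that D(5) by (auto simp: dual_act_def fun_eq_iff)
  moreover have "dual_act U act (x \<oplus>\<^bsub>q\<^esub> y) \<xi> = dual_act U act x \<xi> \<oplus>\<^bsub>dual U\<^esub> dual_act U act y \<xi>"
    if "x \<in> carrier q" "y \<in> carrier q" "\<xi> \<in> carrier (dual U)" for x y \<xi>
    using that D by (auto simp: dual_act_def fun_eq_iff dual_add)
  moreover have "dual_act U act (c \<odot>\<^bsub>q\<^esub> x) \<xi> = c \<odot>\<^bsub>dual U\<^esub> dual_act U act x \<xi>"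
    if "x \<in> carrier q" "\<xi> \<in> carrier (dual U)" for c x \<xi>
    using that D by (auto simp: dual_act_def fun_eq_iff dual_smult)
  ultimately show ?thesis
    using D(1) fdvs_dual(1)[OF D(2)] closed unfolding linear_action_def by blast
qed

text \<open>\<open>K\<close> acts trivially, so it lies in the stabiliser of every functional; that
  of \<open>\<xi>0\<close> is \<open>K\<close> itself. By rank-nullity \<open>\<xi>0\<close> then
  has an orbit tangent of largest dimension.\<close>

lemma ind_eq:
  assumes act: "linear_action q U act" and K: "K \<subseteq> carrier q"
    and triv: "\<And>x u. x \<in> K \<Longrightarrow> u \<in> carrier U \<Longrightarrow> act x u = \<zero>\<^bsub>U\<^esub>"
    and \<xi>0: "\<xi>0 \<in> carrier (dual U)"
    and stab: "\<And>x. x \<in> carrier q \<Longrightarrow> (\<And>u. u \<in> carrier U \<Longrightarrow> \<xi>0 (act x u) = 0) \<Longrightarrow> x \<in> K"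
  shows "ind q U act = int (vdim U) - (int (vdim q) - int (vdim (q\<lparr>carrier := K\<rparr>)))"
proof -
  note D = linear_actionD[OF act]
  have dact: "linear_action q (dual U) (dual_act U act)" using act by (rule linear_action_dual)
  define ker where "ker \<xi> = {x \<in> carrier q. dual_act U act x \<xi> = \<zero>\<^bsub>dual U\<^esub>}" for \<xi>
  define d where "d \<xi> = vdim ((dual U)\<lparr>carrier := orbit_tangent q (dual_act U act) \<xi>\<rparr>)" for \<xi>
  have sub: "subspace class_ring (ker \<xi>) q" if "\<xi> \<in> carrier (dual U)" for \<xi>
    unfolding ker_def
    using linear_map_kernel_subspace[OF linear_action_orbit_map[OF dact that]] .
  have rn: "d \<xi> + vdim (q\<lparr>carrier := ker \<xi>\<rparr>) = vdim q" if "\<xi> \<in> carrier (dual U)" for \<xi>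
    using rank_nullity_fdvs[OF D(1) linear_action_orbit_map[OF dact that]]
    by (simp add: d_def ker_def orbit_tangent_def)
  have K_sub: "K \<subseteq> ker \<xi>" if "\<xi> \<in> carrier (dual U)" for \<xi>
    using K triv dual_zero_arg[OF D(4) that] by (auto simp: ker_def dual_act_def)
  have "ker \<xi>0 \<subseteq> K"
  proof
    fix x assume x: "x \<in> ker \<xi>0"
    have "\<xi>0 (act x u) = 0" if "u \<in> carrier U" for u
    proof -
      have "dual_act U act x \<xi>0 u = \<zero>\<^bsub>dual U\<^esub> u" using x by (simp add: ker_def)
      then show ?thesis using that by (simp add: dual_act_def)
    qed
    then show "x \<in> K" using x stab by (simp add: ker_def)
  qed
  then have ker: "ker \<xi>0 = K" using K_sub \<xi>0 by blast
  have le: "d \<xi> \<le> d \<xi>0" if "\<xi> \<in> carrier (dual U)" for \<xi>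
    using rn[OF that] rn[OF \<xi>0] vdim_subspace_mono[OF D(1) sub[OF \<xi>0] sub[OF that]]
      K_sub[OF that] ker by simp
  \<comment> \<open>\<open>Max\<close> is meaningful only for finite sets. There may be infinitely
    many functionals, but their orbit dimensions are bounded by \<open>d \<xi>0\<close>.\<close>
  have "Max (d ` carrier (dual U)) = d \<xi>0"
  proof (rule Max_eqI)
    show "finite (d ` carrier (dual U))"
      by (rule finite_subset[of _ "{..d \<xi>0}"]) (use le in auto)
  qed (use le \<xi>0 in auto)
  then show ?thesis
    using rn[OF \<xi>0] unfolding ker ind_def d_def[symmetric] by simp
qed

text \<open>The functional on the dual of \<open>U\<close> is evaluation at \<open>u0\<close>. It
  vanishes on all \<open>dual_act U act x \<eta>\<close> exactly when every \<open>\<eta>\<close>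
  vanishes on \<open>act x u0\<close>, that is, when \<open>act x u0\<close> is zero. Thus a vector
  with stabiliser inside \<open>K\<close> computes the index of the dual module.\<close>

lemma ind_dual_eq:
  assumes act: "linear_action q U act" and K: "K \<subseteq> carrier q"
    and triv: "\<And>x u. x \<in> K \<Longrightarrow> u \<in> carrier U \<Longrightarrow> act x u = \<zero>\<^bsub>U\<^esub>"
    and u0: "u0 \<in> carrier U"
    and stab: "\<And>x. x \<in> carrier q \<Longrightarrow> act x u0 = \<zero>\<^bsub>U\<^esub> \<Longrightarrow> x \<in> K"
  shows "ind q (dual U) (dual_act U act) =
    int (vdim U) - (int (vdim q) - int (vdim (q\<lparr>carrier := K\<rparr>)))"
proof -
  note D = linear_actionD[OF act]
  note dact = linear_action_dual[OF act]
  have "ind q (dual U) (dual_act U act) =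
      int (vdim (dual U)) - (int (vdim q) - int (vdim (q\<lparr>carrier := K\<rparr>)))"
  proof (rule ind_eq[OF dact K])
    show "dual_act U act x \<eta> = \<zero>\<^bsub>dual U\<^esub>" if "x \<in> K" "\<eta> \<in> carrier (dual U)" for x \<eta>
      using that triv dual_zero_arg[OF D(4) that(2)] by (auto simp: dual_act_def)
    show "(\<lambda>\<eta>\<in>carrier (dual U). \<eta> u0) \<in> carrier (dual (dual U))"
      using D(4) u0 by (rule evaluation_mem_dual)
    fix x
    assume x: "x \<in> carrier q"
      and "\<And>\<eta>. \<eta> \<in> carrier (dual U) \<Longrightarrow> (\<lambda>\<eta>\<in>carrier (dual U). \<eta> u0) (dual_act U act x \<eta>) = 0"
    then have "dual_act U act x \<eta> u0 = 0" if "\<eta> \<in> carrier (dual U)" for \<eta>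
      using that linear_actionD(5)[OF dact x that] by fastforce
    then have "\<eta> (act x u0) = 0" if "\<eta> \<in> carrier (dual U)" for \<eta>
      using that u0 by (simp add: dual_act_def)
    then have "act x u0 = \<zero>\<^bsub>U\<^esub>"
      using dual_separates[OF D(2) D(5)[OF x u0]] by blast
    then show "x \<in> K" using stab x by blast
  qed
  then show ?thesis using fdvs_dual(2)[OF D(2)] by simp
qed

section \<open>Direct sums of copies\<close>

lemma copies_simps [simp]:
  "carrier (copies m W) = {..<m} \<rightarrow>\<^sub>E carrier W"
  "u \<oplus>\<^bsub>copies m W\<^esub> v = (\<lambda>i\<in>{..<m}. u i \<oplus>\<^bsub>W\<^esub> v i)"
  "c \<odot>\<^bsub>copies m W\<^esub> u = (\<lambda>i\<in>{..<m}. c \<odot>\<^bsub>W\<^esub> u i)"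
  "\<zero>\<^bsub>copies m W\<^esub> = (\<lambda>i\<in>{..<m}. \<zero>\<^bsub>W\<^esub>)"
  by (simp_all add: copies_def)

lemma copies_eqI:
  assumes "u \<in> carrier (copies m W)" "v \<in> carrier (copies m W)" "\<And>i. i < m \<Longrightarrow> u i = v i"
  shows "u = v"
  using assms by (auto intro: PiE_ext)

lemma vectorspace_copies:
  fixes W :: "('k :: field, 'w) module"
  assumes "vectorspace class_ring W"
  shows "vectorspace class_ring (copies m W)"
proof -
  note W = vectorspace_class_ringD[OF assms]
  have mem: "u i \<in> carrier W" if "u \<in> carrier (copies m W)" "i < m" for u i
    using that by auto
  have zero: "\<zero>\<^bsub>copies m W\<^esub> \<in> carrier (copies m W)"
    using W(1) by auto
  have add: "u \<oplus>\<^bsub>copies m W\<^esub> v \<in> carrier (copies m W)"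
    if "u \<in> carrier (copies m W)" "v \<in> carrier (copies m W)" for u v
    using that W(2) by auto
  have smult: "c \<odot>\<^bsub>copies m W\<^esub> u \<in> carrier (copies m W)"
    if "u \<in> carrier (copies m W)" for c u
    using that W(3) by auto
  note [simp del] = copies_simps(1)
  note closed = zero add smult
  show ?thesis
  proof (rule vectorspace_class_ringI)
    fix u v assume "u \<in> carrier (copies m W)" "v \<in> carrier (copies m W)"
    then show "u \<oplus>\<^bsub>copies m W\<^esub> v = v \<oplus>\<^bsub>copies m W\<^esub> u"
      by (intro copies_eqI[of _ m W] closed) (auto intro: W(4) mem)
  next
    fix u v w
    assume "u \<in> carrier (copies m W)" "v \<in> carrier (copies m W)" "w \<in> carrier (copies m W)"
    then show "(u \<oplus>\<^bsub>copies m W\<^esub> v) \<oplus>\<^bsub>copies m W\<^esub> w = u \<oplus>\<^bsub>copies m W\<^esub> (v \<oplus>\<^bsub>copies m W\<^esub> w)"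
      by (intro copies_eqI[of _ m W] closed) (auto intro: W(5) mem)
  next
    fix u assume u: "u \<in> carrier (copies m W)"
    show "u \<oplus>\<^bsub>copies m W\<^esub> \<zero>\<^bsub>copies m W\<^esub> = u"
      by (intro copies_eqI[of _ m W] closed u) (simp add: W(6) mem[OF u])
    show "u \<oplus>\<^bsub>copies m W\<^esub> ((- 1) \<odot>\<^bsub>copies m W\<^esub> u) = \<zero>\<^bsub>copies m W\<^esub>"
      by (intro copies_eqI[of _ m W] closed u) (simp add: W(8) mem[OF u])
    show "1 \<odot>\<^bsub>copies m W\<^esub> u = u"
      by (intro copies_eqI[of _ m W] closed u) (simp add: W(10) mem[OF u])
    fix a b
    show "(a * b) \<odot>\<^bsub>copies m W\<^esub> u = a \<odot>\<^bsub>copies m W\<^esub> (b \<odot>\<^bsub>copies m W\<^esub> u)"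
      by (intro copies_eqI[of _ m W] closed u) (simp add: W(9) mem[OF u])
    show "(a + b) \<odot>\<^bsub>copies m W\<^esub> u = a \<odot>\<^bsub>copies m W\<^esub> u \<oplus>\<^bsub>copies m W\<^esub> b \<odot>\<^bsub>copies m W\<^esub> u"
      by (intro copies_eqI[of _ m W] closed u) (simp add: W(11) mem[OF u])
  next
    fix a u v assume "u \<in> carrier (copies m W)" "v \<in> carrier (copies m W)"
    then show "a \<odot>\<^bsub>copies m W\<^esub> (u \<oplus>\<^bsub>copies m W\<^esub> v) =
        a \<odot>\<^bsub>copies m W\<^esub> u \<oplus>\<^bsub>copies m W\<^esub> a \<odot>\<^bsub>copies m W\<^esub> v"
      by (intro copies_eqI[of _ m W] closed) (auto intro: W(12) mem)
  qed (intro closed; assumption)+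
qed

definition copies_single :: "nat \<Rightarrow> ('k, 'w) module \<Rightarrow> nat \<Rightarrow> 'w \<Rightarrow> nat \<Rightarrow> 'w"
  where "copies_single m W i w = (\<lambda>j\<in>{..<m}. if j = i then w else \<zero>\<^bsub>W\<^esub>)"

lemma copies_single_carrier:
  assumes "vectorspace class_ring W" "w \<in> carrier W"
  shows "copies_single m W i w \<in> carrier (copies m W)"
proof -
  interpret vectorspace class_ring W by fact
  show ?thesis using assms by (auto simp: copies_single_def)
qed

lemma component_mem_dual:
  assumes "vectorspace class_ring W" "\<phi> \<in> carrier (dual W)" "i < m"
  shows "(\<lambda>u\<in>carrier (copies m W). \<phi> (u i)) \<in> carrier (dual (copies m W))"
proof (rule dual_memI)
  fix u v assume "u \<in> carrier (copies m W)" "v \<in> carrier (copies m W)"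
  then have "u i \<in> carrier W" "v i \<in> carrier W" using assms(3) by auto
  then show "\<phi> ((u \<oplus>\<^bsub>copies m W\<^esub> v) i) = \<phi> (u i) + \<phi> (v i)"
    using dual_add[OF assms(2), of "u i" "v i"] assms(3) by simp
next
  fix c u assume "u \<in> carrier (copies m W)"
  then have "u i \<in> carrier W" using assms(3) by auto
  then show "\<phi> ((c \<odot>\<^bsub>copies m W\<^esub> u) i) = c * \<phi> (u i)"
    using dual_smult[OF assms(2), of "u i" c] assms(3) by simp
qed (rule vectorspace_copies[OF assms(1)])

text \<open>Pairs of a slot and a basis vector index a dual system: \<open>e (i, x)\<close> puts
  \<open>x\<close> into slot \<open>i\<close>, and \<open>C (i, x)\<close> reads the coordinate
  \<open>c x\<close> there.\<close>

lemma fdvs_copies: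
  fixes W :: "('k :: field, 'w) module"
  assumes "fdvs W"
  shows "fdvs (copies m W)" "vdim (copies m W) = m * vdim W"
proof -
  have W: "vectorspace class_ring W" using assms by (simp add: fdvs_def)
  then interpret vectorspace class_ring W .
  obtain X c where ds: "dual_system W X (\<lambda>x. x) c" "card X = vdim W"
    using assms by (rule fdvs_dual_system)
  then have X: "finite X" "X \<subseteq> carrier W" and c: "\<And>x. x \<in> X \<Longrightarrow> c x \<in> carrier (dual W)"
    and cx: "\<And>x y. x \<in> X \<Longrightarrow> y \<in> X \<Longrightarrow> c x y = (if x = y then 1 else 0)"
    and sep: "\<And>w. w \<in> carrier W \<Longrightarrow> (\<And>x. x \<in> X \<Longrightarrow> c x w = 0) \<Longrightarrow> w = \<zero>\<^bsub>W\<^esub>"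
    by (auto simp: dual_system_def)
  define e where "e p = copies_single m W (fst p) (snd p)" for p
  define C where "C p = (\<lambda>u\<in>carrier (copies m W). c (snd p) (u (fst p)))" for p
  have e: "e p \<in> carrier (copies m W)" if "p \<in> {..<m} \<times> X" for p
    unfolding e_def using that X by (intro copies_single_carrier[OF W]) auto
  have *: "dual_system (copies m W) ({..<m} \<times> X) e C"
    unfolding dual_system_def
  proof (intro conjI ballI impI)
    show "C \<in> {..<m} \<times> X \<rightarrow> carrier (dual (copies m W))"
      unfolding C_def using component_mem_dual[OF W] c by auto
    show "C p (e r) = (if p = r then 1 else 0)"
      if "p \<in> {..<m} \<times> X" "r \<in> {..<m} \<times> X" for p r
    proof -
      have "C p (e r) = c (snd p) (e r (fst p))"
        using e[OF that(2)] by (simp add: C_def)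
      also have "\<dots> = (if fst p = fst r then c (snd p) (snd r) else c (snd p) \<zero>\<^bsub>W\<^esub>)"
        using that by (auto simp: e_def copies_single_def)
      also have "\<dots> = (if p = r then 1 else 0)"
        using that by (auto simp: cx dual_zero_arg[OF W c] prod_eq_iff)
      finally show ?thesis .
    qed
    show "u = \<zero>\<^bsub>copies m W\<^esub>"
      if u: "u \<in> carrier (copies m W)" and 0: "\<forall>p\<in>{..<m} \<times> X. C p u = 0" for u
    proof (rule copies_eqI[OF u])
      show "\<zero>\<^bsub>copies m W\<^esub> \<in> carrier (copies m W)" by simp
      fix i assume i: "i < m"
      have "c x (u i) = 0" if "x \<in> X" for x
      proof -
        have "C (i, x) u = 0" using 0 that i by blast
        then show ?thesis using u by (simp add: C_def)
      qed
      then have "u i = \<zero>\<^bsub>W\<^esub>" using u i by (intro sep) auto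
      then show "u i = \<zero>\<^bsub>copies m W\<^esub> i" using i by simp
    qed
  qed (use X e in auto)
  then show "fdvs (copies m W)"
    using fdvsI[OF vectorspace_copies[OF W]] by blast
  show "vdim (copies m W) = m * vdim W"
    using dual_system_fin_dim(2)[OF vectorspace_copies[OF W] *] ds(2)
    by (simp add: card_cartesian_product)
qed

text \<open>Stated under a functional so that the sum is one of scalars; inside
  \<open>copies m W\<close> the tuple is built up by its truncations \<open>t k\<close>, one slot at
  a time.\<close>

lemma copies_eq_sum_single:
  fixes W :: "('k :: field, 'w) module"
  assumes W: "vectorspace class_ring W" and \<Phi>: "\<Phi> \<in> carrier (dual (copies m W))"
    and u: "u \<in> carrier (copies m W)"
  shows "\<Phi> u = (\<Sum>i<m. \<Phi> (copies_single m W i (u i)))"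
proof -
  have ui: "u i \<in> carrier W" if "i < m" for i using u that by auto
  define t where "t k = (\<lambda>i\<in>{..<m}. if i < k then u i else \<zero>\<^bsub>W\<^esub>)" for k
  have t: "t k \<in> carrier (copies m W)" for k
    using ui vectorspace_class_ringD(1)[OF W] by (auto simp: t_def)
  have partial: "k \<le> m \<Longrightarrow> \<Phi> (t k) = (\<Sum>i<k. \<Phi> (copies_single m W i (u i)))" for k
  proof (induction k)
    case 0
    have "\<Phi> (t 0) = \<Phi> \<zero>\<^bsub>copies m W\<^esub>"
      by (rule arg_cong[of _ _ \<Phi>]) (simp add: t_def)
    also have "\<dots> = 0"
      by (rule dual_zero_arg[OF vectorspace_copies[OF W] \<Phi>])
    finally show ?case by simp
  next
    case (Suc k)
    have single: "copies_single m W k (u k) \<in> carrier (copies m W)"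
      using Suc.prems ui by (intro copies_single_carrier[OF W]) auto
    have "t (Suc k) = t k \<oplus>\<^bsub>copies m W\<^esub> copies_single m W k (u k)"
    proof (rule copies_eqI[of _ m W])
      show "t k \<oplus>\<^bsub>copies m W\<^esub> copies_single m W k (u k) \<in> carrier (copies m W)"
        using vectorspace_class_ringD(2)[OF vectorspace_copies[OF W] t single] .
      fix i assume i: "i < m"
      consider "i < k" | "i = k" | "k < i" by linarith
      then show "t (Suc k) i = (t k \<oplus>\<^bsub>copies m W\<^esub> copies_single m W k (u k)) i"
        by cases (use i ui[OF i] in \<open>simp_all add: t_def copies_single_def vectorspace_class_ringD(1,6,7)[OF W]\<close>)
    qed (rule t)
    then have "\<Phi> (t (Suc k)) = \<Phi> (t k) + \<Phi> (copies_single m W k (u k))"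
      by (simp only: dual_add[OF \<Phi> t single])
    then show ?case
      using Suc.IH Suc.prems by simp
  qed
  have "t m = u"
    using t[of m] u by (rule copies_eqI) (simp add: t_def)
  then show ?thesis using partial[of m] by simp
qed

text \<open>Component \<open>i\<close> is the restriction of \<open>\<Phi>\<close> to tuples
  supported in slot \<open>i\<close>.\<close>

lemma dual_copies:
  assumes W: "vectorspace class_ring W" and \<Phi>: "\<Phi> \<in> carrier (dual (copies m W))"
  obtains \<phi> where "\<forall>i<m. \<phi> i \<in> carrier (dual W)"
    "\<forall>u\<in>carrier (copies m W). \<Phi> u = (\<Sum>i<m. \<phi> i (u i))"
proof (rule that; intro allI impI ballI)
  interpret vectorspace class_ring W by fact
  note single = copies_single_carrier[OF W]
  show "(\<lambda>w\<in>carrier W. \<Phi> (copies_single m W i w)) \<in> carrier (dual W)" if "i < m" for i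
  proof (rule dual_memI[OF _ _ W])
    fix v w assume vw: "v \<in> carrier W" "w \<in> carrier W"
    have "copies_single m W i (v \<oplus>\<^bsub>W\<^esub> w) = copies_single m W i v \<oplus>\<^bsub>copies m W\<^esub> copies_single m W i w"
      by (rule ext) (use vw in \<open>simp add: copies_single_def\<close>)
    then show "\<Phi> (copies_single m W i (v \<oplus>\<^bsub>W\<^esub> w)) =
        \<Phi> (copies_single m W i v) + \<Phi> (copies_single m W i w)"
      using dual_add[OF \<Phi> single[OF vw(1)] single[OF vw(2)]] by (simp only:)
  next
    fix c w assume w: "w \<in> carrier W"
    have "c \<odot>\<^bsub>W\<^esub> \<zero>\<^bsub>W\<^esub> = \<zero>\<^bsub>W\<^esub>" using W by (rule vectorspace_class_ringD)
    then have "copies_single m W i (c \<odot>\<^bsub>W\<^esub> w) = c \<odot>\<^bsub>copies m W\<^esub> copies_single m W i w"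
      by (intro ext) (simp add: copies_single_def)
    then show "\<Phi> (copies_single m W i (c \<odot>\<^bsub>W\<^esub> w)) = c * \<Phi> (copies_single m W i w)"
      using dual_smult[OF \<Phi> single[OF w]] by (simp only:)
  qed
  show "\<Phi> u = (\<Sum>i<m. (\<lambda>w\<in>carrier W. \<Phi> (copies_single m W i w)) (u i))"
    if "u \<in> carrier (copies m W)" for u
  proof -
    have "u i \<in> carrier W" if "i < m" for i
      using that \<open>u \<in> carrier (copies m W)\<close> by auto
    then have "(\<Sum>i<m. (\<lambda>w\<in>carrier W. \<Phi> (copies_single m W i w)) (u i)) =
        (\<Sum>i<m. \<Phi> (copies_single m W i (u i)))"
      by (intro sum.cong) auto
    then show ?thesis using copies_eq_sum_single[OF W \<Phi> that] by simp
  qed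
qed


section \<open>Quotient spaces\<close>

text \<open>Every vector space law survives a surjection that respects the operations. For a
  quotient space this leaves only the compatibility of the coset map to check.\<close>

lemma vectorspace_image:
  fixes V :: "('k :: field, 'v) module" and W :: "('k, 'w) module"
  assumes V: "vectorspace class_ring V" and im: "carrier W = f ` carrier V"
    and zero: "f \<zero>\<^bsub>V\<^esub> = \<zero>\<^bsub>W\<^esub>"
    and add: "\<And>v w. v \<in> carrier V \<Longrightarrow> w \<in> carrier V \<Longrightarrow> f (v \<oplus>\<^bsub>V\<^esub> w) = f v \<oplus>\<^bsub>W\<^esub> f w"
    and smult: "\<And>c v. v \<in> carrier V \<Longrightarrow> f (c \<odot>\<^bsub>V\<^esub> v) = c \<odot>\<^bsub>W\<^esub> f v"
  shows "vectorspace class_ring W" "linear_map class_ring V W f"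
proof -
  note D = vectorspace_class_ringD[OF V]
  show W: "vectorspace class_ring W"
    by (rule vectorspace_class_ringI)
      (auto simp: im zero[symmetric] add[symmetric] smult[symmetric] D(1-3,5-)
        intro!: arg_cong[of _ _ f] D(4))
  show "linear_map class_ring V W f"
    using V W by (rule linear_map_class_ringI) (auto simp: im add smult)
qed

context
  fixes V :: "('k :: field, 'v) module" and S :: "'v set"
  assumes V: "vectorspace class_ring V" and S: "subspace class_ring S V"
begin

lemma subspace_closed:
  shows "S \<subseteq> carrier V" "\<zero>\<^bsub>V\<^esub> \<in> S" "\<And>v w. v \<in> S \<Longrightarrow> w \<in> S \<Longrightarrow> v \<oplus>\<^bsub>V\<^esub> w \<in> S"
    "\<And>c v. v \<in> S \<Longrightarrow> c \<odot>\<^bsub>V\<^esub> v \<in> S"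
  using S by (auto simp: subspace_def submodule_def)

text \<open>Opens the coset arithmetic of abelian groups; closure under negation is scaling by
  -1.\<close>

lemma subspace_abelian_subgroup: "abelian_subgroup S V"
proof -
  interpret vectorspace class_ring V by (fact V)
  have neg: "\<ominus>\<^bsub>V\<^esub> v \<in> S" if "v \<in> S" for v
    using that subspace_closed(4)[of v "- 1"] subspace_closed(1) smult_minus_1[of v]
    by (auto simp: class_ring_simps)
  have "additive_subgroup S V"
    unfolding additive_subgroup_def
    using subspace_closed neg
    by (intro group.subgroupI) (auto simp: M.a_group a_inv_def[symmetric])
  then show ?thesis
    by (rule abelian_subgroupI3) (rule M.abelian_group_axioms)
qed

interpretation abelian_subgroup S V by (rule subspace_abelian_subgroup)

lemma coset_mem_iff: "w \<in> S +>\<^bsub>V\<^esub> v \<longleftrightarrow> (\<exists>s\<in>S. w = s \<oplus>\<^bsub>V\<^esub> v)"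
  by (auto simp: a_r_coset_def')

lemma coset_zero_iff: "v \<in> carrier V \<Longrightarrow> S +>\<^bsub>V\<^esub> v = S \<longleftrightarrow> v \<in> S"
  using a_rcos_self[of v] a_coset_join2[OF _ a_subgroup] by auto

text \<open>Scalar multiplication and the induced action on a quotient are both unions of this
  shape. All cosets in the union coincide, since \<open>f\<close> maps the coset of \<open>v\<close>
  into that of \<open>f v\<close>.\<close>

lemma coset_union:
  assumes v: "v \<in> carrier V" and fS: "\<And>s. s \<in> S \<Longrightarrow> f s \<in> S" and fv: "f v \<in> carrier V"
    and f: "\<And>s. s \<in> S \<Longrightarrow> f (s \<oplus>\<^bsub>V\<^esub> v) = f s \<oplus>\<^bsub>V\<^esub> f v"
  shows "(\<Union>a\<in>S +>\<^bsub>V\<^esub> v. S +>\<^bsub>V\<^esub> f a) = S +>\<^bsub>V\<^esub> f v"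
proof -
  have "S +>\<^bsub>V\<^esub> f a = S +>\<^bsub>V\<^esub> f v" if a: "a \<in> S +>\<^bsub>V\<^esub> v" for a
  proof -
    obtain s where s: "s \<in> S" "a = s \<oplus>\<^bsub>V\<^esub> v" using a coset_mem_iff by blast
    then have "f a \<in> S +>\<^bsub>V\<^esub> f v" using fS f coset_mem_iff by blast
    then show ?thesis using a_repr_independence'[of "f a" "f v"] fv by blast
  qed
  moreover have "v \<in> S +>\<^bsub>V\<^esub> v" using v by (rule a_rcos_self)
  ultimately show ?thesis by blast
qed

lemma quotient_space_ops:
  shows "carrier (quotient_space V S) = (\<lambda>v. S +>\<^bsub>V\<^esub> v) ` carrier V"
    and "\<zero>\<^bsub>quotient_space V S\<^esub> = S"
    and "\<And>v w. v \<in> carrier V \<Longrightarrow> w \<in> carrier V \<Longrightarrow>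
      S +>\<^bsub>V\<^esub> (v \<oplus>\<^bsub>V\<^esub> w) = (S +>\<^bsub>V\<^esub> v) \<oplus>\<^bsub>quotient_space V S\<^esub> (S +>\<^bsub>V\<^esub> w)"
    and "\<And>c v. v \<in> carrier V \<Longrightarrow>
      S +>\<^bsub>V\<^esub> (c \<odot>\<^bsub>V\<^esub> v) = c \<odot>\<^bsub>quotient_space V S\<^esub> (S +>\<^bsub>V\<^esub> v)"
proof -
  note D = vectorspace_class_ringD[OF V]
  show "carrier (quotient_space V S) = (\<lambda>v. S +>\<^bsub>V\<^esub> v) ` carrier V"
    by (auto simp: quotient_space_def A_RCOSETS_def')
  show "\<zero>\<^bsub>quotient_space V S\<^esub> = S"
    by (simp add: quotient_space_def)
  show "S +>\<^bsub>V\<^esub> (v \<oplus>\<^bsub>V\<^esub> w) = (S +>\<^bsub>V\<^esub> v) \<oplus>\<^bsub>quotient_space V S\<^esub> (S +>\<^bsub>V\<^esub> w)"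
    if "v \<in> carrier V" "w \<in> carrier V" for v w
    using a_rcos_sum[OF that] by (simp add: quotient_space_def)
  show "S +>\<^bsub>V\<^esub> (c \<odot>\<^bsub>V\<^esub> v) = c \<odot>\<^bsub>quotient_space V S\<^esub> (S +>\<^bsub>V\<^esub> v)" if v: "v \<in> carrier V" for c v
  proof -
    have "(\<Union>a\<in>S +>\<^bsub>V\<^esub> v. S +>\<^bsub>V\<^esub> (c \<odot>\<^bsub>V\<^esub> a)) = S +>\<^bsub>V\<^esub> (c \<odot>\<^bsub>V\<^esub> v)"
      by (rule coset_union) (use v D(3,12) subspace_closed in auto)
    then show ?thesis by (simp add: quotient_space_def)
  qed
qed

lemma quotient_projection:
  shows "vectorspace class_ring (quotient_space V S)"
    and "linear_map class_ring V (quotient_space V S) (\<lambda>v. S +>\<^bsub>V\<^esub> v)"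
proof -
  have zero: "S +>\<^bsub>V\<^esub> \<zero>\<^bsub>V\<^esub> = \<zero>\<^bsub>quotient_space V S\<^esub>"
    using coset_zero_iff[of "\<zero>\<^bsub>V\<^esub>"] subspace_closed quotient_space_ops(2) by auto
  show "vectorspace class_ring (quotient_space V S)"
    "linear_map class_ring V (quotient_space V S) (\<lambda>v. S +>\<^bsub>V\<^esub> v)"
    using vectorspace_image[OF V quotient_space_ops(1) zero quotient_space_ops(3,4)] by blast+
qed

lemma fdvs_quotient:
  assumes fd: "fdvs V"
  shows "fdvs (quotient_space V S)"
    and "vdim (quotient_space V S) + vdim (V\<lparr>carrier := S\<rparr>) = vdim V"
proof -
  interpret linear_map class_ring V "quotient_space V S" "\<lambda>v. S +>\<^bsub>V\<^esub> v"
    by (rule quotient_projection)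
  show "fdvs (quotient_space V S)"
    using surj_fin_dim quotient_projection(1) fd quotient_space_ops(1) unfolding fdvs_def by metis
  have "{v \<in> carrier V. S +>\<^bsub>V\<^esub> v = \<zero>\<^bsub>quotient_space V S\<^esub>} = S"
    using coset_zero_iff quotient_space_ops(2) subspace_closed(1) by auto
  moreover have "(quotient_space V S)\<lparr>carrier := (\<lambda>v. S +>\<^bsub>V\<^esub> v) ` carrier V\<rparr> = quotient_space V S"
    unfolding quotient_space_ops(1)[symmetric] by simp
  ultimately show "vdim (quotient_space V S) + vdim (V\<lparr>carrier := S\<rparr>) = vdim V"
    using rank_nullity_fdvs[OF fd quotient_projection(2)] by (simp only:)
qed

lemma quotient_act_coset:
  assumes act: "linear_action q V act" and x: "x \<in> carrier q" and inv: "\<And>s. s \<in> S \<Longrightarrow> act x s \<in> S"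
    and v: "v \<in> carrier V"
  shows "quotient_act V S act x (S +>\<^bsub>V\<^esub> v) = S +>\<^bsub>V\<^esub> act x v"
  unfolding quotient_act_def
  by (rule coset_union)
    (use v x inv linear_actionD(5,6)[OF act] subspace_closed(1) in auto)

lemma linear_action_quotient:
  assumes act: "linear_action q V act" and inv: "\<And>x s. x \<in> carrier q \<Longrightarrow> s \<in> S \<Longrightarrow> act x s \<in> S"
  shows "linear_action q (quotient_space V S) (quotient_act V S act)"
proof -
  note D = linear_actionD[OF act] and VD = vectorspace_class_ringD[OF V]
  note qD = vectorspace_class_ringD[OF linear_actionD(3)[OF act]]
  note Q = quotient_space_ops
  have qa: "quotient_act V S act x (S +>\<^bsub>V\<^esub> v) = S +>\<^bsub>V\<^esub> act x v"
    if "x \<in> carrier q" "v \<in> carrier V" for x v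
    using that inv by (intro quotient_act_coset[OF act]) auto
  show ?thesis
    unfolding linear_action_def Q(1) ball_simps
    using fdvs_quotient(1)[OF D(2)] D(1)
    by (auto simp only: qa Q(3,4)[symmetric] D(5-9) VD(2,3) qD(2,3))
qed

end

section \<open>The index of a multiple and of its slices\<close>

text \<open>The entries \<open>u i\<close> complete a maximal independent subfamily of \<open>v\<close> to a generating system
  of \<open>W\<close>; they are placed outside the index set \<open>I\<close> of that subfamily, where there is room because
  \<open>dim W \<le> m\<close>.\<close>
lemma complementary_family:
  fixes W :: "('k :: field, 'w) module"
  assumes fd: "fdvs W" and dim: "vdim W \<le> m" and fam: "v \<in> {..<m} \<rightarrow> carrier W"
  shows "\<exists>I u. I \<subseteq> {..<m} \<and> u \<in> carrier (copies m W) \<and> (\<forall>i\<in>I. u i = \<zero>\<^bsub>W\<^esub>) \<and>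
    (\<forall>T. subspace class_ring T W \<longrightarrow> (\<forall>i\<in>I. v i \<in> T) \<longrightarrow> (\<forall>i<m. v i \<in> T)) \<and>
    (\<forall>T. subspace class_ring T W \<longrightarrow> (\<forall>i<m. v i \<in> T) \<longrightarrow> (\<forall>i<m. u i \<in> T) \<longrightarrow> carrier W \<subseteq> T)"
proof -
  have v: "v i \<in> carrier W" if "i < m" for i using fam that by auto
  have W: "vectorspace class_ring W" and fin_dim: "vectorspace.fin_dim class_ring W"
    using fd by (simp_all add: fdvs_def)
  interpret vectorspace class_ring W by (fact W)
  \<comment> \<open>A maximal independent set of entries spans every entry: adding an entry outside
    it makes it dependent.\<close>
  define P where "P A \<longleftrightarrow> A \<subseteq> v ` {..<m} \<and> lin_indpt A" for A
  have "P {}"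
    unfolding P_def lin_dep_def by auto
  moreover have "finite A \<and> card A \<le> card (v ` {..<m})" if "P A" for A
    using that finite_subset[of A "v ` {..<m}"] card_mono[of "v ` {..<m}" A] by (auto simp: P_def)
  ultimately obtain A where A: "finite A" "maximal A P"
    using maximal_exists[of P "card (v ` {..<m})" "{}"] by blast
  have indep: "lin_indpt A" and Av: "A \<subseteq> v ` {..<m}" and max: "\<And>B. A \<subseteq> B \<Longrightarrow> P B \<Longrightarrow> B = A"
    using A(2) unfolding maximal_def P_def by blast+
  have AW: "A \<subseteq> carrier W" using Av v by auto
  have vA: "v i \<in> span A" if i: "i < m" for i
  proof (cases "v i \<in> A")
    case True
    then show ?thesis using in_own_span[OF AW] by blast
  next
    case False
    then have "\<not> P (A \<union> {v i})" using max[of "A \<union> {v i}"] by blast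
    then have "lin_dep (A \<union> {v i})" using Av i unfolding P_def by blast
    then show ?thesis using lin_dep_iff_in_span[OF AW indep v[OF i] False] by blast
  qed
  obtain B where B: "finite B" "basis B"
    using finite_basis_exists[OF fin_dim] by blast
  have BW: "B \<subseteq> carrier W" "span B = carrier W" using B(2) by (simp_all add: basis_def)
  \<comment> \<open>Steinitz exchange: at most dim W - card A vectors complete \<open>A\<close> to a
    generating set.\<close>
  obtain C where C: "finite C" "C \<subseteq> carrier W" "int (card C) \<le> int (card B) - int (card A)"
    "span (A \<union> C) = span B"
    using replacement[OF A(1) B(1) BW(1) indep] AW BW(2) by blast
  \<comment> \<open>One index for each vector of \<open>A\<close>, as entries of \<open>v\<close>
    may repeat.\<close>
  define I where "I = inv_into {..<m} v ` A"
  have I: "I \<subseteq> {..<m}" "\<And>a. a \<in> A \<Longrightarrow> \<exists>i\<in>I. v i = a"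
    using Av inv_into_into[of _ v "{..<m}"] f_inv_into_f[of _ v "{..<m}"]
    by (auto simp: I_def subset_iff)
  \<comment> \<open>Room for \<open>C\<close> outside \<open>I\<close>: \<open>card C\<close> is at
    most dim W - card A, \<open>card I\<close> is at most \<open>card A\<close>, and dim W is at
    most \<open>m\<close>.\<close>
  have "card C + card I \<le> m"
    using C(3) dim dim_basis[OF B] card_image_le[OF A(1), of "inv_into {..<m} v"] by (simp add: I_def)
  then have "card C \<le> card ({..<m} - I)"
    using card_Diff_subset[OF finite_subset[OF I(1)] I(1)] by simp
  then obtain h where h: "h ` C \<subseteq> {..<m} - I" "inj_on h C"
    using card_le_inj[of C "{..<m} - I"] C(1) by auto
  define u where "u = (\<lambda>i\<in>{..<m}. if i \<in> h ` C then inv_into C h i else \<zero>\<^bsub>W\<^esub>)"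
  have hC: "h c < m" "u (h c) = c" if "c \<in> C" for c
    using that h by (auto simp: u_def)
  have "inv_into C h i \<in> carrier W" if "i \<in> h ` C" for i
    using inv_into_into[OF that] C(2) by blast
  then have u: "u \<in> carrier (copies m W)"
    by (auto simp: u_def)
  show ?thesis
  proof (intro exI conjI allI impI ballI)
    show "I \<subseteq> {..<m}" "u \<in> carrier (copies m W)" by (fact I(1), fact u)
    show "u i = \<zero>\<^bsub>W\<^esub>" if "i \<in> I" for i
      using that I(1) h(1) by (auto simp: u_def)
  next
    fix T i assume T: "subspace class_ring T W" and vT: "\<forall>i\<in>I. v i \<in> T" and i: "i < m"
    have "A \<subseteq> T" using I(2) vT by blast
    then have "span A \<subseteq> T" using T by (intro span_is_subset) (simp_all add: subspace_def)
    then show "v i \<in> T" using vA[OF i] by blast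
  next
    fix T assume T: "subspace class_ring T W" and vT: "\<forall>i<m. v i \<in> T" and uT: "\<forall>i<m. u i \<in> T"
    have "A \<subseteq> T" using Av vT by auto
    moreover have "c \<in> T" if "c \<in> C" for c
      using uT hC[OF that] by metis
    ultimately have "A \<union> C \<subseteq> T" by blast
    then have "span (A \<union> C) \<subseteq> T" using T by (intro span_is_subset) (simp_all add: subspace_def)
    then show "carrier W \<subseteq> T" using C(4) BW(2) by simp
  qed
qed

text \<open>\<open>W\<close> stands for the dual of \<open>V\<close>, and \<open>act\<close> for the
  differential on the multiple of \<open>W\<close>; the latter is a definite description that is
  computed on carriers only, hence an equation in place of a definition. In \<open>bracket\<close>
  the element \<open>z\<close> is [x, y], chosen before \<open>w\<close>; the identity is arranged
  without subtraction.\<close>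

locale copies_action =
  fixes q :: "('k :: field, 'q) module" and W :: "('k, 'w) module" and \<beta> m act
  assumes \<beta>: "linear_action q W \<beta>"
    and bracket: "\<And>x y. x \<in> carrier q \<Longrightarrow> y \<in> carrier q \<Longrightarrow>
      \<exists>z\<in>carrier q. \<forall>w\<in>carrier W. \<beta> x (\<beta> y w) = \<beta> z w \<oplus>\<^bsub>W\<^esub> \<beta> y (\<beta> x w)"
    and act: "\<And>x u. x \<in> carrier q \<Longrightarrow> u \<in> carrier (copies m W) \<Longrightarrow> act x u = (\<lambda>i\<in>{..<m}. \<beta> x (u i))"
    and dim: "vdim W \<le> m"
begin

section \<open>Functionals, vectors and cosets with stabiliser \<open>K\<close>\<close>

definition U where "U = copies m W"
definition K where "K = {x \<in> carrier q. \<forall>w\<in>carrier W. \<beta> x w = \<zero>\<^bsub>W\<^esub>}"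

lemma U_mem: "u \<in> carrier U \<Longrightarrow> i < m \<Longrightarrow> u i \<in> carrier W"
  by (auto simp: U_def)

lemma act_apply: "x \<in> carrier q \<Longrightarrow> u \<in> carrier U \<Longrightarrow> i < m \<Longrightarrow> act x u i = \<beta> x (u i)"
  by (simp add: U_def act)

lemma U_eqI: "u \<in> carrier U \<Longrightarrow> w \<in> carrier U \<Longrightarrow> (\<And>i. i < m \<Longrightarrow> u i = w i) \<Longrightarrow> u = w"
  unfolding U_def by (rule copies_eqI)

lemma U_apply [simp]:
  assumes "i < m"
  shows "(u \<oplus>\<^bsub>U\<^esub> w) i = u i \<oplus>\<^bsub>W\<^esub> w i" "(c \<odot>\<^bsub>U\<^esub> u) i = c \<odot>\<^bsub>W\<^esub> u i" "\<zero>\<^bsub>U\<^esub> i = \<zero>\<^bsub>W\<^esub>"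
  using assms by (simp_all add: U_def)

lemma fdvs_U: "fdvs U" "vdim U = m * vdim W"
  using fdvs_copies linear_actionD(2)[OF \<beta>] by (simp_all add: U_def)

lemma act_linear: "linear_action q U act"
proof -
  note B = linear_actionD[OF \<beta>]
  note UD = vectorspace_class_ringD[OF fdvs_U(1)[unfolded fdvs_def, THEN conjunct1]]
  note qD = vectorspace_class_ringD[OF B(3)]
  have closed: "act x u \<in> carrier U" if "x \<in> carrier q" "u \<in> carrier U" for x u
    using that B(5) by (auto simp: act U_def)
  show ?thesis
    unfolding linear_action_def
    using B(1) fdvs_U(1)
    by (auto intro!: U_eqI closed UD(2,3) qD(2,3) simp: act_apply U_mem B UD(2,3) qD(2,3))
qed

text \<open>These kernels are the subspaces \<open>T\<close> to which
  \<open>complementary_family\<close> is applied: if \<open>x\<close> kills a generating family of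
  \<open>W\<close>, its kernel is all of \<open>W\<close> and \<open>x\<close> lies in
  \<open>K\<close>.\<close>

lemma kernel_subspace: "x \<in> carrier q \<Longrightarrow> subspace class_ring {w \<in> carrier W. \<beta> x w = \<zero>\<^bsub>W\<^esub>} W"
  by (rule linear_map_kernel_subspace[OF linear_action_map[OF \<beta>]])

lemma K_trivial:
  assumes "x \<in> K" "u \<in> carrier U"
  shows "act x u = \<zero>\<^bsub>U\<^esub>"
proof (rule U_eqI)
  have x: "x \<in> carrier q" using assms by (simp add: K_def)
  show "act x u \<in> carrier U" using linear_actionD(5)[OF act_linear x assms(2)] .
  show "\<zero>\<^bsub>U\<^esub> \<in> carrier U" using fdvs_U(1) vectorspace_class_ringD(1) by (auto simp: fdvs_def)
  show "act x u i = \<zero>\<^bsub>U\<^esub> i" if "i < m" for i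
    using that assms x U_mem by (simp add: act_apply K_def)
qed

lemma K_subset: "K \<subseteq> carrier q"
  by (auto simp: K_def)

text \<open>The chosen functional sums the coordinates \<open>c x\<close>, each read from its own
  slot \<open>f x\<close>. Seen as a tuple of functionals on \<open>W\<close> it contains a basis of
  the dual of \<open>W\<close>; the bound on dim W provides the injection \<open>f\<close> into the
  slots.\<close>

lemma ind_copies:
  "ind q U act = int (m * vdim W) - (int (vdim q) - int (vdim (q\<lparr>carrier := K\<rparr>)))"
proof -
  note B = linear_actionD[OF \<beta>]
  obtain X c where ds: "dual_system W X (\<lambda>x. x) c" "card X = vdim W"
    using B(2) by (rule fdvs_dual_system)
  then have X: "finite X" and c: "\<And>x. x \<in> X \<Longrightarrow> c x \<in> carrier (dual W)"
    and sep: "\<And>w. w \<in> carrier W \<Longrightarrow> (\<And>x. x \<in> X \<Longrightarrow> c x w = 0) \<Longrightarrow> w = \<zero>\<^bsub>W\<^esub>"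
    by (auto simp: dual_system_def)
  obtain f where f: "f ` X \<subseteq> {..<m}" "inj_on f X"
    using card_le_inj[of X "{..<m}"] X ds(2) dim by auto
  then have fm: "\<And>x. x \<in> X \<Longrightarrow> f x < m" by auto
  have "ind q U act = int (vdim U) - (int (vdim q) - int (vdim (q\<lparr>carrier := K\<rparr>)))"
  proof (rule ind_eq[OF act_linear K_subset K_trivial])
    show "(\<lambda>u\<in>carrier U. \<Sum>x\<in>X. c x (u (f x))) \<in> carrier (dual U)"
    proof (rule dual_memI)
      show "vectorspace class_ring U" using fdvs_U(1) by (simp add: fdvs_def)
      show "(\<Sum>x\<in>X. c x ((u \<oplus>\<^bsub>U\<^esub> w) (f x))) = (\<Sum>x\<in>X. c x (u (f x))) + (\<Sum>x\<in>X. c x (w (f x)))"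
        if "u \<in> carrier U" "w \<in> carrier U" for u w
        unfolding sum.distrib[symmetric]
        by (rule sum.cong) (use that fm U_mem in \<open>simp_all add: dual_add[OF c]\<close>)
      show "(\<Sum>x\<in>X. c x ((k \<odot>\<^bsub>U\<^esub> u) (f x))) = k * (\<Sum>x\<in>X. c x (u (f x)))"
        if "u \<in> carrier U" for k u
        unfolding sum_distrib_left
        by (rule sum.cong) (use that fm U_mem in \<open>simp_all add: dual_smult[OF c]\<close>)
    qed
    fix x assume x: "x \<in> carrier q"
      and zero: "\<And>u. u \<in> carrier U \<Longrightarrow> (\<lambda>u\<in>carrier U. \<Sum>x\<in>X. c x (u (f x))) (act x u) = 0"
    have "\<beta> x w = \<zero>\<^bsub>W\<^esub>" if w: "w \<in> carrier W" for w
    proof (rule sep)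
      show "\<beta> x w \<in> carrier W" using B(5)[OF x w] .
      fix y assume y: "y \<in> X"
      \<comment> \<open>Testing with \<open>w\<close> in slot \<open>f y\<close> leaves only the
        summand of \<open>y\<close>, since \<open>f\<close> is injective.\<close>
      define s where "s = copies_single m W (f y) w"
      have s: "s \<in> carrier U" unfolding s_def U_def by (rule copies_single_carrier[OF B(4) w])
      have "0 = (\<Sum>z\<in>X. c z (act x s (f z)))"
        using zero[OF s] linear_actionD(5)[OF act_linear x s] by simp
      also have "\<dots> = (\<Sum>z\<in>X. if z = y then c z (\<beta> x w) else 0)"
      proof (rule sum.cong)
        fix z assume z: "z \<in> X"
        have "s (f z) = (if z = y then w else \<zero>\<^bsub>W\<^esub>)"
          using y z fm inj_onD[OF f(2), of z y] by (auto simp: s_def copies_single_def)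
        then show "c z (act x s (f z)) = (if z = y then c z (\<beta> x w) else 0)"
          using z fm x s linear_action_zero[OF \<beta> x] dual_zero_arg[OF B(4) c[OF z]]
          by (simp add: act_apply)
      qed simp
      also have "\<dots> = c y (\<beta> x w)" using X y by simp
      finally show "c y (\<beta> x w) = 0" by simp
    qed
    then show "x \<in> K" using x by (simp add: K_def)
  qed
  then show ?thesis by (simp add: fdvs_U(2))
qed

lemma ind_dual_copies:
  "ind q (dual U) (dual_act U act) =
    int (m * vdim W) - (int (vdim q) - int (vdim (q\<lparr>carrier := K\<rparr>)))"
proof -
  note B = linear_actionD[OF \<beta>]
  have W0: "\<zero>\<^bsub>W\<^esub> \<in> carrier W" by (rule vectorspace_class_ringD(1)[OF B(4)])
  \<comment> \<open>For the zero family the complementary tuple \<open>u\<close> generates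
    \<open>W\<close> by itself.\<close>
  have "(\<lambda>_. \<zero>\<^bsub>W\<^esub>) \<in> {..<m} \<rightarrow> carrier W" using W0 by simp
  from complementary_family[OF B(2) dim this]
  obtain u where u: "u \<in> carrier (copies m W)"
    and gen: "\<forall>T. subspace class_ring T W \<longrightarrow> (\<forall>i<m. \<zero>\<^bsub>W\<^esub> \<in> T) \<longrightarrow> (\<forall>i<m. u i \<in> T) \<longrightarrow> carrier W \<subseteq> T"
    by (elim exE conjE) (rule that)
  have uU: "u \<in> carrier U" using u(1) by (simp add: U_def)
  have "ind q (dual U) (dual_act U act) =
      int (vdim U) - (int (vdim q) - int (vdim (q\<lparr>carrier := K\<rparr>)))"
  proof (rule ind_dual_eq[OF act_linear K_subset K_trivial uU])
    fix x assume x: "x \<in> carrier q" and 0: "act x u = \<zero>\<^bsub>U\<^esub>"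
    have "\<beta> x (u i) = \<zero>\<^bsub>W\<^esub>" if "i < m" for i
      using act_apply[OF x uU that] that by (simp add: 0)
    then have "carrier W \<subseteq> {w \<in> carrier W. \<beta> x w = \<zero>\<^bsub>W\<^esub>}"
      using U_mem[OF uU] W0 linear_action_zero[OF \<beta> x]
      by (intro gen[rule_format] kernel_subspace x) auto
    then show "x \<in> K" using x by (auto simp: K_def)
  qed
  then show ?thesis by (simp add: fdvs_U(2))
qed

text \<open>The dimension of \<open>q_v\<close> cancels: the quotient has dimension m dim W - (dim q
  - dim q_v), and dim q_v - dim K is subtracted from it. Hence the value is that of
  \<open>ind_dual_copies\<close>, whatever \<open>v\<close> is.\<close>

lemma ind_dual_slice:
  assumes v: "v \<in> carrier U"
  defines "S \<equiv> orbit_tangent q act v"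
  defines "UW \<equiv> quotient_space U S"
  shows "ind (stabiliser q U act v) (dual UW) (dual_act UW (quotient_act U S act)) =
    int (m * vdim W) - (int (vdim q) - int (vdim (q\<lparr>carrier := K\<rparr>)))"
proof -
  note B = linear_actionD[OF \<beta>] and A = linear_actionD[OF act_linear]
  define H where "H = {x \<in> carrier q. act x v = \<zero>\<^bsub>U\<^esub>}"
  have stab: "stabiliser q U act v = q\<lparr>carrier := H\<rparr>"
    by (simp add: stabiliser_def H_def)
  have om: "linear_map class_ring q U (\<lambda>x. act x v)"
    by (rule linear_action_orbit_map[OF act_linear v])
  have H: "subspace class_ring H q"
    unfolding H_def by (rule linear_map_kernel_subspace[OF om])
  interpret om: linear_map class_ring q U "\<lambda>x. act x v" by (fact om)
  have S: "subspace class_ring S U"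
    using om.imT_is_subspace unfolding S_def orbit_tangent_def om.im_def .
  have rn: "vdim (U\<lparr>carrier := S\<rparr>) + vdim (q\<lparr>carrier := H\<rparr>) = vdim q"
    using rank_nullity_fdvs[OF A(1) om] by (simp add: S_def orbit_tangent_def H_def)
  have Hv: "\<beta> x (v i) = \<zero>\<^bsub>W\<^esub>" if "x \<in> H" "i < m" for x i
    using that act_apply[OF _ v, of x i] by (simp add: H_def)
  \<comment> \<open>\<open>x (y v) = [x, y] v + y (x v)\<close>; this is the only use of the bracket.\<close>
  have inv: "act x s \<in> S" if x: "x \<in> H" and s: "s \<in> S" for x s
  proof -
    have xq: "x \<in> carrier q" using x by (simp add: H_def)
    obtain y where y: "y \<in> carrier q" "s = act y v"
      using s by (auto simp: S_def orbit_tangent_def)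
    obtain z where z: "z \<in> carrier q" "\<And>w. w \<in> carrier W \<Longrightarrow> \<beta> x (\<beta> y w) = \<beta> z w \<oplus>\<^bsub>W\<^esub> \<beta> y (\<beta> x w)"
      using bracket[OF xq y(1)] by blast
    have "act x s = act z v"
    proof (rule U_eqI)
      show "act x s \<in> carrier U" "act z v \<in> carrier U"
        using A(5) xq y z(1) v by simp_all
      fix i assume i: "i < m"
      have "act x s i = \<beta> x (\<beta> y (v i))"
        using xq y A(5)[OF y(1) v] i v by (simp add: act_apply)
      also have "\<dots> = \<beta> z (v i) \<oplus>\<^bsub>W\<^esub> \<zero>\<^bsub>W\<^esub>"
        using z(2)[OF U_mem[OF v i]] Hv[OF x i] linear_action_zero[OF \<beta> y(1)] by simp
      also have "\<dots> = act z v i"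
        using vectorspace_class_ringD(6)[OF B(4) B(5)[OF z(1) U_mem[OF v i]]] act_apply[OF z(1) v i]
        by simp
      finally show "act x s i = act z v i" .
    qed
    then show ?thesis using z(1) by (simp add: S_def orbit_tangent_def)
  qed
  have HK: "K \<subseteq> H"
    using K_trivial v K_subset by (auto simp: H_def)
  have actH: "linear_action (q\<lparr>carrier := H\<rparr>) U act"
    by (rule linear_action_subspace[OF act_linear H])
  have qact: "linear_action (q\<lparr>carrier := H\<rparr>) UW (quotient_act U S act)"
    unfolding UW_def by (rule linear_action_quotient[OF A(4) S actH]) (simp add: inv)
  have coset: "quotient_act U S act x (S +>\<^bsub>U\<^esub> u) = S +>\<^bsub>U\<^esub> act x u"
    if "x \<in> H" "u \<in> carrier U" for x u
    by (rule quotient_act_coset[OF A(4) S actH]) (use that inv in auto)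
  have UW: "carrier UW = (\<lambda>u. S +>\<^bsub>U\<^esub> u) ` carrier U" "\<zero>\<^bsub>UW\<^esub> = S"
    unfolding UW_def by (rule quotient_space_ops[OF A(4) S])+
  have "v \<in> {..<m} \<rightarrow> carrier W" using U_mem[OF v] by simp
  from complementary_family[OF B(2) dim this]
  obtain I u where I: "I \<subseteq> {..<m}" and u: "u \<in> carrier (copies m W)"
    and uI: "\<forall>i\<in>I. u i = \<zero>\<^bsub>W\<^esub>"
    and vI: "\<forall>T. subspace class_ring T W \<longrightarrow> (\<forall>i\<in>I. v i \<in> T) \<longrightarrow> (\<forall>i<m. v i \<in> T)"
    and gen: "\<forall>T. subspace class_ring T W \<longrightarrow> (\<forall>i<m. v i \<in> T) \<longrightarrow> (\<forall>i<m. u i \<in> T) \<longrightarrow> carrier W \<subseteq> T"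
    by (elim exE conjE) (rule that)
  have uU: "u \<in> carrier U" using u by (simp add: U_def)
  have "ind (q\<lparr>carrier := H\<rparr>) (dual UW) (dual_act UW (quotient_act U S act)) =
    int (vdim UW) - (int (vdim (q\<lparr>carrier := H\<rparr>)) -
      int (vdim (q\<lparr>carrier := H\<rparr>\<lparr>carrier := K\<rparr>)))"
  proof (rule ind_dual_eq[OF qact, where ?u0.0 = "S +>\<^bsub>U\<^esub> u"])
    show "K \<subseteq> carrier (q\<lparr>carrier := H\<rparr>)" using HK by simp
    show "S +>\<^bsub>U\<^esub> u \<in> carrier UW" using uU by (simp add: UW)
    show "quotient_act U S act x C = \<zero>\<^bsub>UW\<^esub>" if "x \<in> K" "C \<in> carrier UW" for x C
    proof -
      obtain w where w: "w \<in> carrier U" "C = S +>\<^bsub>U\<^esub> w" using \<open>C \<in> carrier UW\<close> by (auto simp: UW)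
      then have "quotient_act U S act x C = S +>\<^bsub>U\<^esub> \<zero>\<^bsub>U\<^esub>"
        using coset[of x w] K_trivial that(1) HK by auto
      also have "\<dots> = S"
        using coset_zero_iff[OF A(4) S] subspace_closed(1,2)[OF A(4) S] by blast
      finally show ?thesis by (simp add: UW)
    qed
    fix x assume "x \<in> carrier (q\<lparr>carrier := H\<rparr>)" and 0: "quotient_act U S act x (S +>\<^bsub>U\<^esub> u) = \<zero>\<^bsub>UW\<^esub>"
    then have x: "x \<in> H" and xq: "x \<in> carrier q" by (simp_all add: H_def)
    have xu: "act x u \<in> carrier U" using A(5)[OF xq uU] .
    have "S +>\<^bsub>U\<^esub> act x u = S" using 0 coset[OF x uU] by (simp add: UW)
    then have "act x u \<in> S" using coset_zero_iff[OF A(4) S xu] by blast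
    then obtain y where y: "y \<in> carrier q" "act x u = act y v"
      by (auto simp: S_def orbit_tangent_def)
    have xy: "\<beta> x (u i) = \<beta> y (v i)" if "i < m" for i
      using act_apply[OF xq uU that] act_apply[OF y(1) v that] y(2) by simp
    have "\<forall>i<m. v i \<in> {w \<in> carrier W. \<beta> y w = \<zero>\<^bsub>W\<^esub>}"
    proof (rule vI[THEN spec, THEN mp, THEN mp, OF kernel_subspace[OF y(1)]], rule ballI)
      fix j assume j: "j \<in> I"
      then have "j < m" using I by auto
      then show "v j \<in> {w \<in> carrier W. \<beta> y w = \<zero>\<^bsub>W\<^esub>}"
        using xy[of j] bspec[OF uI j] linear_action_zero[OF \<beta> xq] U_mem[OF v] by simp
    qed
    then have "\<beta> x (u i) = \<zero>\<^bsub>W\<^esub>" if "i < m" for i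
      using xy that by simp
    then have "carrier W \<subseteq> {w \<in> carrier W. \<beta> x w = \<zero>\<^bsub>W\<^esub>}"
      using Hv[OF x] U_mem[OF v] U_mem[OF uU] by (intro gen[rule_format] kernel_subspace xq) auto
    then show "x \<in> K" using xq by (auto simp: K_def)
  qed
  moreover have "vdim UW + vdim (U\<lparr>carrier := S\<rparr>) = m * vdim W"
    unfolding UW_def using fdvs_quotient(2)[OF A(4) S A(2)] by (simp add: fdvs_U(2))
  moreover from this have "int (vdim UW) = int (m * vdim W) - int (vdim q) + int (vdim (q\<lparr>carrier := H\<rparr>))"
    using rn by linarith
  ultimately show ?thesis
    unfolding stab by simp
qed

end

section \<open>The Lie algebra of an affine algebraic group\<close>

context affine_algebraic_group
begin

section \<open>The coordinate ring and its operations\<close>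

definition fadd :: "('g \<Rightarrow> 'k) \<Rightarrow> ('g \<Rightarrow> 'k) \<Rightarrow> 'g \<Rightarrow> 'k"
  where "fadd f h = (\<lambda>x\<in>carrier Q. f x + h x)"
definition fmul :: "('g \<Rightarrow> 'k) \<Rightarrow> ('g \<Rightarrow> 'k) \<Rightarrow> 'g \<Rightarrow> 'k"
  where "fmul f h = (\<lambda>x\<in>carrier Q. f x * h x)"
definition fscale :: "'k \<Rightarrow> ('g \<Rightarrow> 'k) \<Rightarrow> 'g \<Rightarrow> 'k"
  where "fscale c f = (\<lambda>x\<in>carrier Q. c * f x)"
definition fconst :: "'k \<Rightarrow> 'g \<Rightarrow> 'k"
  where "fconst c = (\<lambda>x\<in>carrier Q. c)"
text \<open>The antipode of the Hopf algebra k[Q], whose coproduct is described by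
  \<open>mult_morphism\<close>.\<close>

definition finv :: "('g \<Rightarrow> 'k) \<Rightarrow> 'g \<Rightarrow> 'k"
  where "finv f = (\<lambda>x\<in>carrier Q. f (inv x))"

lemma f_apply [simp]:
  assumes "x \<in> carrier Q"
  shows "fadd f h x = f x + h x" "fmul f h x = f x * h x" "fscale c f x = c * f x"
    "fconst c x = c" "finv f x = f (inv x)" "left_translate Q g f x = f (inv g \<otimes> x)"
  using assms by (simp_all add: fadd_def fmul_def fscale_def fconst_def finv_def left_translate_def)

lemma A_extensional: "f \<in> A \<Longrightarrow> f \<in> extensional (carrier Q)"
  using function_algebra by (auto simp: function_algebra_def PiE_def)

lemma A_eqI: "f \<in> A \<Longrightarrow> h \<in> A \<Longrightarrow> (\<And>x. x \<in> carrier Q \<Longrightarrow> f x = h x) \<Longrightarrow> f = h"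
  using A_extensional by (blast intro: extensionalityI)

lemma A_fconst: "fconst c \<in> A"
  and A_fadd: "f \<in> A \<Longrightarrow> h \<in> A \<Longrightarrow> fadd f h \<in> A"
  and A_fmul: "f \<in> A \<Longrightarrow> h \<in> A \<Longrightarrow> fmul f h \<in> A"
  using function_algebra by (auto simp: function_algebra_def fadd_def fmul_def fconst_def)

lemma A_fscale: "f \<in> A \<Longrightarrow> fscale c f \<in> A"
proof -
  assume f: "f \<in> A"
  have "fscale c f = fmul (fconst c) f"
    unfolding fscale_def fmul_def by (rule restrict_ext) simp
  then show ?thesis using A_fmul[OF A_fconst f] by simp
qed

lemma A_finv: "f \<in> A \<Longrightarrow> finv f \<in> A"
  using inv_morphism by (simp add: finv_def)

lemma A_sum:
  fixes N :: nat
  assumes "\<And>i. i < N \<Longrightarrow> f i \<in> A"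
  shows "(\<lambda>x\<in>carrier Q. \<Sum>i<N. f i x) \<in> A"
  using assms
proof (induction N)
  case 0
  have "(\<lambda>x\<in>carrier Q. \<Sum>i<0. f i x) = fconst 0"
    unfolding fconst_def by (rule restrict_ext) simp
  then show ?case by (simp only: A_fconst)
next
  case (Suc N)
  have "(\<lambda>x\<in>carrier Q. \<Sum>i<Suc N. f i x) = fadd (\<lambda>x\<in>carrier Q. \<Sum>i<N. f i x) (f N)"
    unfolding fadd_def by (rule restrict_ext) simp
  moreover have "f N \<in> A" using Suc.prems by simp
  moreover have "(\<lambda>x\<in>carrier Q. \<Sum>i<N. f i x) \<in> A"
    by (rule Suc.IH) (use Suc.prems in auto)
  ultimately show ?case by (simp only: A_fadd)
qed

text \<open>With the first argument frozen at \<open>inv g\<close>, the coproduct formula writes the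
  translate as a linear combination of the \<open>b i\<close>.\<close>

lemma A_left_translate:
  assumes g: "g \<in> carrier Q" and f: "f \<in> A"
  shows "left_translate Q g f \<in> A"
proof -
  obtain N :: nat and a b where ab: "\<forall>i<N. a i \<in> A \<and> b i \<in> A"
    "\<forall>x\<in>carrier Q. \<forall>y\<in>carrier Q. f (x \<otimes> y) = (\<Sum>i<N. a i x * b i y)"
    using mult_morphism[OF f] by blast
  have "left_translate Q g f = (\<lambda>x\<in>carrier Q. \<Sum>i<N. fscale (a i (inv g)) (b i) x)"
    unfolding left_translate_def by (rule restrict_ext) (simp add: ab(2) g)
  also have "\<dots> \<in> A"
    by (rule A_sum) (use ab(1) A_fscale in auto)
  finally show ?thesis .
qed

lemmas A_closed = A_fadd A_fmul A_fscale A_left_translate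

section \<open>Left-invariant derivations of the coordinate ring\<close>

abbreviation L where "L \<equiv> lie_algebra_of Q A"

lemma L_D:
  assumes "D \<in> carrier L"
  shows "f \<in> A \<Longrightarrow> D f \<in> A"
    and "D \<in> extensional A"
    and "f \<in> A \<Longrightarrow> h \<in> A \<Longrightarrow> x \<in> carrier Q \<Longrightarrow> D (fadd f h) x = D f x + D h x"
    and "f \<in> A \<Longrightarrow> x \<in> carrier Q \<Longrightarrow> D (fscale c f) x = c * D f x"
    and "f \<in> A \<Longrightarrow> h \<in> A \<Longrightarrow> x \<in> carrier Q \<Longrightarrow> D (fmul f h) x = D f x * h x + f x * D h x"
    and "f \<in> A \<Longrightarrow> g \<in> carrier Q \<Longrightarrow> x \<in> carrier Q \<Longrightarrow>
      D (left_translate Q g f) x = D f (inv g \<otimes> x)"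
  using assms by (auto simp: lie_algebra_of_def fadd_def fmul_def fscale_def PiE_def)

text \<open>Members of \<open>A\<close> are extensional, so the defining equations between functions
  reduce to pointwise ones.\<close>

lemma L_I:
  assumes "\<And>f. f \<in> A \<Longrightarrow> D f \<in> A" "D \<in> extensional A"
    and "\<And>f h x. f \<in> A \<Longrightarrow> h \<in> A \<Longrightarrow> x \<in> carrier Q \<Longrightarrow> D (fadd f h) x = D f x + D h x"
    and "\<And>c f x. f \<in> A \<Longrightarrow> x \<in> carrier Q \<Longrightarrow> D (fscale c f) x = c * D f x"
    and "\<And>f h x. f \<in> A \<Longrightarrow> h \<in> A \<Longrightarrow> x \<in> carrier Q \<Longrightarrow> D (fmul f h) x = D f x * h x + f x * D h x"
    and "\<And>f g x. f \<in> A \<Longrightarrow> g \<in> carrier Q \<Longrightarrow> x \<in> carrier Q \<Longrightarrow>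
      D (left_translate Q g f) x = D f (inv g \<otimes> x)"
  shows "D \<in> carrier L"
proof -
  note ext = extensionalityI[OF A_extensional restrict_extensional]
  have "D (\<lambda>x\<in>carrier Q. f x + h x) = (\<lambda>x\<in>carrier Q. D f x + D h x)" if "f \<in> A" "h \<in> A" for f h
    unfolding fadd_def[symmetric, of f h]
    by (rule ext[OF assms(1)[OF A_fadd[OF that]]]) (simp add: assms(3) that)
  moreover have "D (\<lambda>x\<in>carrier Q. c * f x) = (\<lambda>x\<in>carrier Q. c * D f x)" if "f \<in> A" for c f
    unfolding fscale_def[symmetric, of c f]
    by (rule ext[OF assms(1)[OF A_fscale[OF that]]]) (simp add: assms(4) that)
  moreover have "D (\<lambda>x\<in>carrier Q. f x * h x) = (\<lambda>x\<in>carrier Q. D f x * h x + f x * D h x)"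
    if "f \<in> A" "h \<in> A" for f h
    unfolding fmul_def[symmetric, of f h]
    by (rule ext[OF assms(1)[OF A_fmul[OF that]]]) (simp add: assms(5) that)
  moreover have "D (left_translate Q g f) = left_translate Q g (D f)"
    if "g \<in> carrier Q" "f \<in> A" for g f
    by (rule A_eqI[OF assms(1)[OF A_left_translate[OF that]] A_left_translate[OF that(1) assms(1)[OF that(2)]]])
      (simp add: assms(6) that)
  ultimately show ?thesis
    using assms(1,2) by (auto simp: lie_algebra_of_def PiE_def)
qed

lemma L_eqI:
  assumes "D \<in> carrier L" "E \<in> carrier L"
    and "\<And>f x. f \<in> A \<Longrightarrow> x \<in> carrier Q \<Longrightarrow> D f x = E f x"
  shows "D = E"
proof (rule extensionalityI[OF L_D(2)[OF assms(1)] L_D(2)[OF assms(2)]])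
  show "D f = E f" if "f \<in> A" for f
    using that assms L_D(1) by (intro A_eqI) auto
qed

lemma L_apply [simp]:
  assumes "f \<in> A" "x \<in> carrier Q"
  shows "(D \<oplus>\<^bsub>L\<^esub> E) f x = D f x + E f x" "(c \<odot>\<^bsub>L\<^esub> D) f x = c * D f x" "\<zero>\<^bsub>L\<^esub> f x = 0"
  using assms by (simp_all add: lie_algebra_of_def)

lemma L_closed:
  shows "\<zero>\<^bsub>L\<^esub> \<in> carrier L"
    and "\<And>D E. D \<in> carrier L \<Longrightarrow> E \<in> carrier L \<Longrightarrow> D \<oplus>\<^bsub>L\<^esub> E \<in> carrier L"
    and "\<And>c D. D \<in> carrier L \<Longrightarrow> c \<odot>\<^bsub>L\<^esub> D \<in> carrier L"
proof -
  show "\<zero>\<^bsub>L\<^esub> \<in> carrier L"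
  proof (rule L_I)
    show "\<zero>\<^bsub>L\<^esub> f \<in> A" if "f \<in> A" for f
      using that A_fconst[of 0] by (simp add: lie_algebra_of_def fconst_def)
    show "\<zero>\<^bsub>L\<^esub> \<in> extensional A" by (simp add: lie_algebra_of_def)
  qed (simp_all add: A_closed)
  show "D \<oplus>\<^bsub>L\<^esub> E \<in> carrier L" if D: "D \<in> carrier L" and E: "E \<in> carrier L" for D E
  proof (rule L_I)
    show "(D \<oplus>\<^bsub>L\<^esub> E) f \<in> A" if "f \<in> A" for f
      using that A_fadd[OF L_D(1)[OF D that] L_D(1)[OF E that]] by (simp add: lie_algebra_of_def fadd_def)
    show "D \<oplus>\<^bsub>L\<^esub> E \<in> extensional A" by (simp add: lie_algebra_of_def)
  qed (simp_all add: A_closed L_D(3-6)[OF D] L_D(3-6)[OF E] algebra_simps)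
  show "c \<odot>\<^bsub>L\<^esub> D \<in> carrier L" if D: "D \<in> carrier L" for c D
  proof (rule L_I)
    show "(c \<odot>\<^bsub>L\<^esub> D) f \<in> A" if "f \<in> A" for f
      using that A_fscale[OF L_D(1)[OF D that]] by (simp add: lie_algebra_of_def fscale_def)
    show "c \<odot>\<^bsub>L\<^esub> D \<in> extensional A" by (simp add: lie_algebra_of_def)
  qed (simp_all add: A_closed L_D(3-6)[OF D] algebra_simps)
qed

lemma vectorspace_L: "vectorspace class_ring L"
  by (rule vectorspace_class_ringI)
    (auto intro!: L_eqI L_closed simp: algebra_simps)

lemma L_hom:
  assumes D: "D \<in> carrier L" and f: "f \<in> A"
  shows "h \<in> A \<Longrightarrow> D (fadd f h) = fadd (D f) (D h)" "D (fscale c f) = fscale c (D f)"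
    "h \<in> A \<Longrightarrow> D (fmul f h) = fadd (fmul (D f) h) (fmul f (D h))"
    "g \<in> carrier Q \<Longrightarrow> D (left_translate Q g f) = left_translate Q g (D f)"
  using f by (auto intro!: A_eqI A_closed L_D(1)[OF D] simp: L_D(3-6)[OF D])

text \<open>The bracket stored in the \<open>mult\<close> field of
  \<open>lie_algebra_of\<close>.\<close>

definition commutator where
  "commutator D E = (\<lambda>f\<in>A. \<lambda>x\<in>carrier Q. D (E f) x - E (D f) x)"

text \<open>In the product rule the mixed terms \<open>D f * E h\<close> and
  \<open>E f * D h\<close> occur in both orders of composition and cancel.\<close>

lemma commutator_L:
  assumes D: "D \<in> carrier L" and E: "E \<in> carrier L"
  shows "commutator D E \<in> carrier L"
proof (rule L_I)
  show "commutator D E f \<in> A" if f: "f \<in> A" for f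
  proof -
    have "commutator D E f = fadd (D (E f)) (fscale (- 1) (E (D f)))"
      using f unfolding commutator_def fadd_def by (auto intro: restrict_ext)
    then show ?thesis using f L_D(1)[OF D] L_D(1)[OF E] by (simp add: A_closed)
  qed
  show "commutator D E \<in> extensional A" by (simp add: commutator_def)
qed (simp_all add: commutator_def A_closed L_hom[OF D] L_hom[OF E] L_D(1)[OF D] L_D(1)[OF E]
      L_D(3-6)[OF D] L_D(3-6)[OF E] algebra_simps)

text \<open>Left invariance recovers a derivation from its tangent vector at the identity, which is
  why \<open>fdvs_L\<close> and \<open>L_mc\<close> can work there.\<close>

lemma L_eval:
  assumes "D \<in> carrier L" "f \<in> A" "g \<in> carrier Q"
  shows "D f g = D (left_translate Q (inv g) f) \<one>"
  using L_D(6)[OF assms(1,2), of "inv g" \<one>] assms(3) by simp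

text \<open>The constant 1 equals its square, so the product rule gives D 1 = D 1 + D 1; other
  constants follow by scaling.\<close>

lemma L_fconst:
  assumes D: "D \<in> carrier L" and x: "x \<in> carrier Q"
  shows "D (fconst c) x = 0"
proof -
  have "fmul (fconst 1) (fconst 1) = fconst (1 :: 'k)"
    by (rule A_eqI) (simp_all add: A_fmul A_fconst)
  then have "D (fconst 1) x = D (fconst 1) x + D (fconst 1) x"
    using L_D(5)[OF D A_fconst A_fconst x, of 1 1] x by simp
  then have "D (fconst 1) x = 0" by (metis add_cancel_right_right)
  moreover have "fconst c = fscale c (fconst 1)"
    by (rule A_eqI) (simp_all add: A_fscale A_fconst)
  ultimately show ?thesis using L_D(4)[OF D A_fconst x] by simp
qed

lemma L_sum:
  fixes N :: nat
  assumes D: "D \<in> carrier L" and x: "x \<in> carrier Q" and f: "\<And>i. i < N \<Longrightarrow> f i \<in> A"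
  shows "D (\<lambda>x\<in>carrier Q. \<Sum>i<N. f i x) x = (\<Sum>i<N. D (f i) x)"
  using f
proof (induction N)
  case 0
  have "(\<lambda>x\<in>carrier Q. \<Sum>i<0. f i x) = fconst 0"
    unfolding fconst_def by (rule restrict_ext) simp
  then show ?case by (simp only: L_fconst[OF D x] lessThan_0 sum.empty)
next
  case (Suc N)
  have "(\<lambda>x\<in>carrier Q. \<Sum>i<Suc N. f i x) = fadd (\<lambda>x\<in>carrier Q. \<Sum>i<N. f i x) (f N)"
    unfolding fadd_def by (rule restrict_ext) simp
  moreover have "D (fadd (\<lambda>x\<in>carrier Q. \<Sum>i<N. f i x) (f N)) x =
      D (\<lambda>x\<in>carrier Q. \<Sum>i<N. f i x) x + D (f N) x"
    using Suc.prems by (intro L_D(3)[OF D _ _ x] A_sum) auto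
  moreover have "D (\<lambda>x\<in>carrier Q. \<Sum>i<N. f i x) x = (\<Sum>i<N. D (f i) x)"
    by (rule Suc.IH) (use Suc.prems in auto)
  ultimately show ?case by (simp only: sum.lessThan_Suc)
qed

text \<open>Differentiate \<open>f 1 = f (x x\<inverse>) = \<Sum>i. a i x * b i (x\<inverse>)\<close> at \<open>x = 1\<close>.\<close>
lemma L_finv:
  assumes D: "D \<in> carrier L" and f: "f \<in> A"
  shows "D (finv f) \<one> = - D f \<one>"
proof -
  obtain N :: nat and a b where ab: "\<forall>i<N. a i \<in> A \<and> b i \<in> A"
    and fab: "\<forall>x\<in>carrier Q. \<forall>y\<in>carrier Q. f (x \<otimes> y) = (\<Sum>i<N. a i x * b i y)"
    using mult_morphism[OF f] by blast
  have A': "a i \<in> A" "b i \<in> A" if "i < N" for i using ab that by auto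
  have "fconst (f \<one>) = (\<lambda>x\<in>carrier Q. \<Sum>i<N. fmul (a i) (finv (b i)) x)"
    unfolding fconst_def by (rule restrict_ext) (use fab in \<open>simp flip: fab\<close>)
  then have "0 = (\<Sum>i<N. D (fmul (a i) (finv (b i))) \<one>)"
    using L_fconst[OF D one_closed, of "f \<one>"] L_sum[OF D one_closed, of N "\<lambda>i. fmul (a i) (finv (b i))"] A'
    by (simp add: A_fmul A_finv)
  also have "\<dots> = (\<Sum>i<N. D (a i) \<one> * b i \<one>) + (\<Sum>i<N. a i \<one> * D (finv (b i)) \<one>)"
    unfolding sum.distrib[symmetric]
    by (rule sum.cong) (simp_all add: A' A_finv L_D(5)[OF D])
  \<comment> \<open>Putting the identity into the second argument of the coproduct formula expresses
    \<open>f\<close> through the \<open>a i\<close>.\<close>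
  also have "(\<Sum>i<N. D (a i) \<one> * b i \<one>) = D f \<one>"
  proof -
    have "f = (\<lambda>x\<in>carrier Q. \<Sum>i<N. fscale (b i \<one>) (a i) x)"
    proof (rule A_eqI[OF f])
      show "(\<lambda>x\<in>carrier Q. \<Sum>i<N. fscale (b i \<one>) (a i) x) \<in> A"
        by (rule A_sum) (simp add: A' A_fscale)
      show "f x = (\<lambda>x\<in>carrier Q. \<Sum>i<N. fscale (b i \<one>) (a i) x) x" if "x \<in> carrier Q" for x
        using fab[rule_format, of x \<one>] that by (simp add: mult.commute)
    qed
    then have "D f \<one> = (\<Sum>i<N. D (fscale (b i \<one>) (a i)) \<one>)"
      using L_sum[OF D one_closed, of N "\<lambda>i. fscale (b i \<one>) (a i)"] A' by (simp add: A_fscale)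
    then show ?thesis by (simp add: L_D(4)[OF D] A' mult.commute)
  qed
  \<comment> \<open>Putting the identity into the first argument and \<open>inv x\<close> into the
    second expresses \<open>finv f\<close> through the \<open>finv (b i)\<close>.\<close>
  also have "(\<Sum>i<N. a i \<one> * D (finv (b i)) \<one>) = D (finv f) \<one>"
  proof -
    have "finv f = (\<lambda>x\<in>carrier Q. \<Sum>i<N. fscale (a i \<one>) (finv (b i)) x)"
      unfolding finv_def[of f]
    proof (rule restrict_ext)
      show "f (inv x) = (\<Sum>i<N. fscale (a i \<one>) (finv (b i)) x)" if "x \<in> carrier Q" for x
        using fab[rule_format, of \<one> "inv x"] that by simp
    qed
    then have "D (finv f) \<one> = (\<Sum>i<N. D (fscale (a i \<one>) (finv (b i))) \<one>)"
      using L_sum[OF D one_closed, of N "\<lambda>i. fscale (a i \<one>) (finv (b i))"] A'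
      by (simp add: A_fscale A_finv)
    then show ?thesis by (simp add: L_D(4)[OF D] A' A_finv)
  qed
  finally have "D f \<one> + D (finv f) \<one> = 0" by (rule sym)
  then show ?thesis by (rule minus_unique[symmetric])
qed

text \<open>A derivation is determined by its values at the identity on finitely many generators of
  \<open>A\<close>, so finitely many functionals separate the points of \<open>L\<close>.\<close>

lemma fdvs_L: "fdvs L"
proof -
  obtain S where S: "finite S" "S \<subseteq> A"
    and gen: "\<forall>B. function_algebra (carrier Q) B \<and> S \<subseteq> B \<longrightarrow> A \<subseteq> B"
    using finitely_generated by (elim exE conjE) (rule that)
  show ?thesis
  proof (rule fdvs_if_separating[OF vectorspace_L, where S = "(\<lambda>f. \<lambda>D\<in>carrier L. D f \<one>) ` S"])
    show "(\<lambda>f. \<lambda>D\<in>carrier L. D f \<one>) ` S \<subseteq> carrier (dual L)"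
    proof (rule image_subsetI, rule dual_memI)
      fix f assume "f \<in> S"
      then have f: "f \<in> A" using S(2) by blast
      show "(D \<oplus>\<^bsub>L\<^esub> E) f \<one> = D f \<one> + E f \<one>" "(c \<odot>\<^bsub>L\<^esub> D) f \<one> = c * D f \<one>" for D E c
        using f by simp_all
    qed (rule vectorspace_L)
    fix D assume D: "D \<in> carrier L"
      and zero: "\<And>\<phi>. \<phi> \<in> (\<lambda>f. \<lambda>D\<in>carrier L. D f \<one>) ` S \<Longrightarrow> \<phi> D = 0"
    \<comment> \<open>By the product rule at the identity \<open>B\<close> is a subalgebra; it
      contains the generators \<open>S\<close>, hence equals \<open>A\<close>.\<close>
    define B where "B = {f \<in> A. D f \<one> = 0}"
    have "fadd f h \<in> B" "fmul f h \<in> B" if "f \<in> B" "h \<in> B" for f h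
      using that by (simp_all add: B_def A_fadd A_fmul L_D(3,5)[OF D])
    moreover have "fconst c \<in> B" for c
      by (simp add: B_def A_fconst L_fconst[OF D])
    moreover have "B \<subseteq> carrier Q \<rightarrow>\<^sub>E UNIV"
      using function_algebra by (auto simp: B_def function_algebra_def)
    ultimately have "function_algebra (carrier Q) B"
      by (simp add: function_algebra_def fadd_def fmul_def fconst_def)
    moreover have "S \<subseteq> B"
    proof
      fix f assume f: "f \<in> S"
      then have "(\<lambda>D\<in>carrier L. D f \<one>) D = 0" by (intro zero) blast
      then show "f \<in> B" using D f S(2) by (auto simp: B_def)
    qed
    ultimately have "A \<subseteq> B" using gen by simp
    then have *: "D f \<one> = 0" if "f \<in> A" for f using that by (auto simp: B_def)
    show "D = \<zero>\<^bsub>L\<^esub>"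
    proof (rule L_eqI[OF D L_closed(1)])
      fix f x assume "f \<in> A" "x \<in> carrier Q"
      then show "D f x = \<zero>\<^bsub>L\<^esub> f x"
        using L_eval[OF D, of f x] * A_left_translate[of "inv x" f] by simp
    qed
  qed (use S in simp)
qed

end

section \<open>Differentials of representations\<close>

text \<open>Uniqueness in the definite description comes from the functionals, which separate points
  in finite dimension.\<close>

lemma differential_eqI:
  assumes "fdvs U" "w \<in> carrier U"
    and "\<And>\<phi>. \<phi> \<in> carrier (dual U) \<Longrightarrow> \<phi> w = D (matrix_coeff Q \<sigma> \<phi> u) \<one>\<^bsub>Q\<^esub>"
  shows "differential Q U \<sigma> D u = w"
  unfolding differential_def
  by (rule the_equality) (use assms in \<open>auto intro: dual_separates_eq[OF assms(1)]\<close>)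

text \<open>The empty family is a dual system here, over any index type.\<close>

lemma vdim_zero_space:
  assumes "vectorspace class_ring V" "carrier V = {\<zero>\<^bsub>V\<^esub>}"
  shows "vdim V = 0"
  using dual_system_fin_dim(2)[OF assms(1), of "{} :: unit set"] assms(2)
  by (simp add: dual_system_def)

locale affine_group_representation = affine_algebraic_group Q A
  for Q (structure) and A :: "('g \<Rightarrow> 'k :: field) set" +
  fixes V :: "('k, 'v) module" and \<rho> :: "'g \<Rightarrow> 'v \<Rightarrow> 'v"
  assumes rep: "rational_rep Q A V \<rho>"
begin

lemma fdvs_V: "fdvs V"
  and vectorspace_V: "vectorspace class_ring V"
  and \<rho>_linear: "g \<in> carrier Q \<Longrightarrow> linear_map class_ring V V (\<rho> g)"
  and \<rho>_mult: "g \<in> carrier Q \<Longrightarrow> h \<in> carrier Q \<Longrightarrow> u \<in> carrier V \<Longrightarrow> \<rho> (g \<otimes> h) u = \<rho> g (\<rho> h u)"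
  and mc_A: "\<phi> \<in> carrier (dual V) \<Longrightarrow> u \<in> carrier V \<Longrightarrow> matrix_coeff Q \<rho> \<phi> u \<in> A"
  using rep by (simp_all add: rational_rep_def fdvs_def)

section \<open>Linearity of the representation and its matrix coefficients\<close>

lemma \<rho>_closed:
  assumes "g \<in> carrier Q" "u \<in> carrier V"
  shows "\<rho> g u \<in> carrier V"
proof -
  interpret linear_map class_ring V V "\<rho> g" using assms(1) by (rule \<rho>_linear)
  show ?thesis using assms(2) by (rule f_im)
qed

lemma \<rho>_add:
  assumes "g \<in> carrier Q" "u \<in> carrier V" "w \<in> carrier V"
  shows "\<rho> g (u \<oplus>\<^bsub>V\<^esub> w) = \<rho> g u \<oplus>\<^bsub>V\<^esub> \<rho> g w"
proof -
  interpret linear_map class_ring V V "\<rho> g" using assms(1) by (rule \<rho>_linear)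
  show ?thesis using assms(2,3) by (rule f_add)
qed

lemma \<rho>_smult:
  assumes "g \<in> carrier Q" "u \<in> carrier V"
  shows "\<rho> g (c \<odot>\<^bsub>V\<^esub> u) = c \<odot>\<^bsub>V\<^esub> \<rho> g u"
proof -
  interpret linear_map class_ring V V "\<rho> g" using assms(1) by (rule \<rho>_linear)
  show ?thesis using f_smult[of c u] assms(2) by simp
qed

abbreviation mc where "mc \<equiv> matrix_coeff Q \<rho>"

lemma mc_apply [simp]: "g \<in> carrier Q \<Longrightarrow> mc \<phi> u g = \<phi> (\<rho> g u)"
  by (simp add: matrix_coeff_def)

lemma V_closed:
  "u \<in> carrier V \<Longrightarrow> w \<in> carrier V \<Longrightarrow> u \<oplus>\<^bsub>V\<^esub> w \<in> carrier V"
  "u \<in> carrier V \<Longrightarrow> c \<odot>\<^bsub>V\<^esub> u \<in> carrier V"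
  using vectorspace_class_ringD(2,3)[OF vectorspace_V] by simp_all

lemma dual_closed:
  "\<phi> \<in> carrier (dual V) \<Longrightarrow> \<psi> \<in> carrier (dual V) \<Longrightarrow> \<phi> \<oplus>\<^bsub>dual V\<^esub> \<psi> \<in> carrier (dual V)"
  "\<phi> \<in> carrier (dual V) \<Longrightarrow> c \<odot>\<^bsub>dual V\<^esub> \<phi> \<in> carrier (dual V)"
  using vectorspace_class_ringD(2,3)[OF vectorspace_dual[OF vectorspace_V]] by blast+

lemma mc_linear:
  assumes "\<phi> \<in> carrier (dual V)" "u \<in> carrier V"
  shows "w \<in> carrier V \<Longrightarrow> mc \<phi> (u \<oplus>\<^bsub>V\<^esub> w) = fadd (mc \<phi> u) (mc \<phi> w)"
    and "mc \<phi> (c \<odot>\<^bsub>V\<^esub> u) = fscale c (mc \<phi> u)"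
    and "\<psi> \<in> carrier (dual V) \<Longrightarrow> mc (\<phi> \<oplus>\<^bsub>dual V\<^esub> \<psi>) u = fadd (mc \<phi> u) (mc \<psi> u)"
    and "mc (c \<odot>\<^bsub>dual V\<^esub> \<phi>) u = fscale c (mc \<phi> u)"
proof -
  note [simp] = dual_add[OF assms(1)] dual_smult[OF assms(1)] \<rho>_add \<rho>_smult \<rho>_closed
  show "mc \<phi> (u \<oplus>\<^bsub>V\<^esub> w) = fadd (mc \<phi> u) (mc \<phi> w)" if "w \<in> carrier V"
    unfolding matrix_coeff_def fadd_def by (rule restrict_ext) (simp add: assms that)
  show "mc \<phi> (c \<odot>\<^bsub>V\<^esub> u) = fscale c (mc \<phi> u)"
    unfolding matrix_coeff_def fscale_def by (rule restrict_ext) (simp add: assms)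
  show "mc (\<phi> \<oplus>\<^bsub>dual V\<^esub> \<psi>) u = fadd (mc \<phi> u) (mc \<psi> u)" if "\<psi> \<in> carrier (dual V)"
    unfolding matrix_coeff_def fadd_def by (rule restrict_ext) (simp add: assms that)
  show "mc (c \<odot>\<^bsub>dual V\<^esub> \<phi>) u = fscale c (mc \<phi> u)"
    unfolding matrix_coeff_def fscale_def by (rule restrict_ext) (simp add: assms)
qed

section \<open>The differential of the representation\<close>

abbreviation d\<rho> where "d\<rho> \<equiv> differential Q V \<rho>"

text \<open>Existence behind the definite description: the derivative of \<open>mc \<phi> u\<close>
  at the identity is linear in \<open>\<phi>\<close>, and by reflexivity such a map is evaluation at
  a vector.\<close>

lemma d\<rho>:
  assumes D: "D \<in> carrier L" and u: "u \<in> carrier V"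
  shows "d\<rho> D u \<in> carrier V"
    and "\<And>\<phi>. \<phi> \<in> carrier (dual V) \<Longrightarrow> \<phi> (d\<rho> D u) = D (mc \<phi> u) \<one>"
proof -
  have mem: "(\<lambda>\<phi>\<in>carrier (dual V). D (mc \<phi> u) \<one>) \<in> carrier (dual (dual V))"
  proof (rule dual_memI)
    fix \<phi> \<psi> assume "\<phi> \<in> carrier (dual V)" "\<psi> \<in> carrier (dual V)"
    then show "D (mc (\<phi> \<oplus>\<^bsub>dual V\<^esub> \<psi>) u) \<one> = D (mc \<phi> u) \<one> + D (mc \<psi> u) \<one>"
      by (simp only: mc_linear u mc_A L_D(3)[OF D] one_closed)
  next
    fix c \<phi> assume "\<phi> \<in> carrier (dual V)"
    then show "D (mc (c \<odot>\<^bsub>dual V\<^esub> \<phi>) u) \<one> = c * D (mc \<phi> u) \<one>"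
      by (simp only: mc_linear u mc_A L_D(4)[OF D] one_closed)
  qed (rule vectorspace_dual[OF vectorspace_V])
  obtain w where w: "w \<in> carrier V"
    and "\<forall>\<phi>\<in>carrier (dual V). (\<lambda>\<phi>\<in>carrier (dual V). D (mc \<phi> u) \<one>) \<phi> = \<phi> w"
    using fdvs_V mem by (rule double_dual)
  then have \<phi>w: "\<phi> w = D (mc \<phi> u) \<one>" if "\<phi> \<in> carrier (dual V)" for \<phi>
    using that by simp
  have "d\<rho> D u = w"
    using fdvs_V w \<phi>w by (rule differential_eqI)
  then show "d\<rho> D u \<in> carrier V" "\<And>\<phi>. \<phi> \<in> carrier (dual V) \<Longrightarrow> \<phi> (d\<rho> D u) = D (mc \<phi> u) \<one>"
    using w \<phi>w by simp_all
qed

lemma linear_action_d\<rho>: "linear_action L V d\<rho>"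
proof -
  note eqI = dual_separates_eq[OF fdvs_V]
  note LD = vectorspace_class_ringD(2,3)[OF vectorspace_L]
  have "d\<rho> D (u \<oplus>\<^bsub>V\<^esub> w) = d\<rho> D u \<oplus>\<^bsub>V\<^esub> d\<rho> D w"
    if "D \<in> carrier L" "u \<in> carrier V" "w \<in> carrier V" for D u w
    by (rule eqI) (simp_all add: that V_closed d\<rho> dual_add mc_linear mc_A L_D(3))
  moreover have "d\<rho> D (c \<odot>\<^bsub>V\<^esub> u) = c \<odot>\<^bsub>V\<^esub> d\<rho> D u"
    if "D \<in> carrier L" "u \<in> carrier V" for D c u
    by (rule eqI) (simp_all add: that V_closed d\<rho> dual_smult mc_linear mc_A L_D(4))
  moreover have "d\<rho> (D \<oplus>\<^bsub>L\<^esub> E) u = d\<rho> D u \<oplus>\<^bsub>V\<^esub> d\<rho> E u"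
    if "D \<in> carrier L" "E \<in> carrier L" "u \<in> carrier V" for D E u
    by (rule eqI) (simp_all add: that V_closed LD d\<rho> dual_add mc_A)
  moreover have "d\<rho> (c \<odot>\<^bsub>L\<^esub> D) u = c \<odot>\<^bsub>V\<^esub> d\<rho> D u"
    if "D \<in> carrier L" "u \<in> carrier V" for c D u
    by (rule eqI) (simp_all add: that V_closed LD d\<rho> dual_smult mc_A)
  ultimately show ?thesis
    using fdvs_L fdvs_V d\<rho>(1) unfolding linear_action_def by blast
qed

text \<open>By left invariance, the derivative of a matrix coefficient is again a matrix coefficient.\<close>
lemma L_mc:
  assumes D: "D \<in> carrier L" and \<phi>: "\<phi> \<in> carrier (dual V)" and u: "u \<in> carrier V"
  shows "D (mc \<phi> u) = mc \<phi> (d\<rho> D u)"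
proof (rule A_eqI)
  show "D (mc \<phi> u) \<in> A" using L_D(1)[OF D mc_A[OF \<phi> u]] .
  show "mc \<phi> (d\<rho> D u) \<in> A" using mc_A[OF \<phi> d\<rho>(1)[OF D u]] .
  fix g assume g: "g \<in> carrier Q"
  \<comment> \<open>\<open>\<psi>\<close> is \<open>\<phi>\<close> composed with
    \<open>\<rho> g\<close>: translating the coefficient moves \<open>g\<close> into the
    functional.\<close>
  define \<psi> where "\<psi> = (\<lambda>v\<in>carrier V. \<phi> (\<rho> g v))"
  have \<psi>: "\<psi> \<in> carrier (dual V)"
    unfolding \<psi>_def
    by (rule dual_memI)
      (simp_all add: g \<rho>_add \<rho>_smult dual_add[OF \<phi>] dual_smult[OF \<phi>] \<rho>_closed vectorspace_V)
  have "left_translate Q (inv g) (mc \<phi> u) = mc \<psi> u"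
    unfolding left_translate_def matrix_coeff_def[of _ _ \<psi>]
    by (rule restrict_ext) (simp add: g u \<psi>_def \<rho>_mult \<rho>_closed)
  then have "D (mc \<phi> u) g = D (mc \<psi> u) \<one>"
    using L_eval[OF D mc_A[OF \<phi> u] g] by simp
  also have "\<dots> = \<psi> (d\<rho> D u)"
    using d\<rho>(2)[OF D u \<psi>] by simp
  also have "\<dots> = mc \<phi> (d\<rho> D u) g"
    using g d\<rho>(1)[OF D u] by (simp add: \<psi>_def)
  finally show "D (mc \<phi> u) g = mc \<phi> (d\<rho> D u) g" .
qed

text \<open>By \<open>L_mc\<close> a derivation acts on the vector argument of a coefficient, so
  \<open>D (E (mc \<phi> u))\<close> takes the value \<open>\<phi> (d\<rho> D (d\<rho> E u))\<close>
  at the identity. Testing by \<open>\<phi>\<close> keeps the difference among scalars.\<close>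

lemma d\<rho>_commutator:
  assumes D: "D \<in> carrier L" and E: "E \<in> carrier L" and u: "u \<in> carrier V"
    and \<phi>: "\<phi> \<in> carrier (dual V)"
  shows "\<phi> (d\<rho> (commutator D E) u) = \<phi> (d\<rho> D (d\<rho> E u)) - \<phi> (d\<rho> E (d\<rho> D u))"
  using d\<rho>(2)[OF commutator_L[OF D E] u \<phi>] d\<rho>[OF D] d\<rho>[OF E] u \<phi>
  by (simp add: commutator_def mc_A L_mc[OF D \<phi> u] L_mc[OF E \<phi> u])

section \<open>The dual action and multiples of the dual\<close>

abbreviation \<beta> where "\<beta> \<equiv> dual_act V d\<rho>"

lemma linear_action_\<beta>: "linear_action L (dual V) \<beta>"
  by (rule linear_action_dual[OF linear_action_d\<rho>])

text \<open>Dualising reverses the order of composition, and the sign in \<open>dual_act\<close>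
  makes up for it. The shape is that of the assumption \<open>bracket\<close> in
  \<open>copies_action\<close>.\<close>

lemma \<beta>_bracket:
  assumes D: "D \<in> carrier L" and E: "E \<in> carrier L" and \<xi>: "\<xi> \<in> carrier (dual V)"
  shows "\<beta> D (\<beta> E \<xi>) = \<beta> (commutator D E) \<xi> \<oplus>\<^bsub>dual V\<^esub> \<beta> E (\<beta> D \<xi>)"
proof (rule dual_eqI)
  note B = linear_actionD(5)[OF linear_action_\<beta>]
  show "\<beta> D (\<beta> E \<xi>) \<in> carrier (dual V)"
    using D E \<xi> by (intro B)
  show "\<beta> (commutator D E) \<xi> \<oplus>\<^bsub>dual V\<^esub> \<beta> E (\<beta> D \<xi>) \<in> carrier (dual V)"
    using D E \<xi> by (intro dual_closed B commutator_L)
  show "\<beta> D (\<beta> E \<xi>) v = (\<beta> (commutator D E) \<xi> \<oplus>\<^bsub>dual V\<^esub> \<beta> E (\<beta> D \<xi>)) v" if v: "v \<in> carrier V" for v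
    using v d\<rho>(1)[OF D v] d\<rho>(1)[OF E v] d\<rho>_commutator[OF D E v \<xi>]
    by (simp add: dual_act_def)
qed

lemma \<beta>_kernel:
  "{D \<in> carrier L. \<forall>\<xi>\<in>carrier (dual V). \<beta> D \<xi> = \<zero>\<^bsub>dual V\<^esub>} =
    {D \<in> carrier L. \<forall>u\<in>carrier V. d\<rho> D u = \<zero>\<^bsub>V\<^esub>}"
proof (intro Collect_cong conj_cong refl iffI ballI)
  fix D u assume D: "D \<in> carrier L" and 0: "\<forall>\<xi>\<in>carrier (dual V). \<beta> D \<xi> = \<zero>\<^bsub>dual V\<^esub>"
    and u: "u \<in> carrier V"
  show "d\<rho> D u = \<zero>\<^bsub>V\<^esub>"
  proof (rule dual_separates[OF fdvs_V d\<rho>(1)[OF D u]])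
    fix \<phi> assume "\<phi> \<in> carrier (dual V)"
    then have "\<beta> D \<phi> u = \<zero>\<^bsub>dual V\<^esub> u" using 0 by simp
    then show "\<phi> (d\<rho> D u) = 0" using u by (simp add: dual_act_def)
  qed
next
  fix D \<xi> assume "\<forall>u\<in>carrier V. d\<rho> D u = \<zero>\<^bsub>V\<^esub>" "\<xi> \<in> carrier (dual V)"
  then show "\<beta> D \<xi> = \<zero>\<^bsub>dual V\<^esub>"
    using dual_zero_arg[OF vectorspace_V] by (auto simp: dual_act_def intro: restrict_ext)
qed

lemma dual_rep_closed:
  assumes "g \<in> carrier Q" "\<xi> \<in> carrier (dual V)"
  shows "dual_rep Q V \<rho> g \<xi> \<in> carrier (dual V)"
  unfolding dual_rep_def
  by (rule dual_memI)
    (simp_all add: assms \<rho>_add \<rho>_smult dual_add[OF assms(2)] dual_smult[OF assms(2)] \<rho>_closed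
      vectorspace_V)

text \<open>By reflexivity a functional on the multiple sends \<open>u\<close> to the sum of the
  \<open>u i (v i)\<close> for suitable vectors \<open>v i\<close> of \<open>V\<close>. Its matrix
  coefficient is the sum of the \<open>finv (mc (u i) (v i))\<close>, and \<open>L_finv\<close>
  turns inversion into the sign of \<open>dual_act\<close>.\<close>

lemma differential_copies_dual:
  assumes D: "D \<in> carrier L" and u: "u \<in> carrier (copies m (dual V))"
  shows "differential Q (copies m (dual V)) (copies_rep m (dual_rep Q V \<rho>)) D u =
    (\<lambda>i\<in>{..<m}. \<beta> D (u i))"
proof (rule differential_eqI)
  let ?U = "copies m (dual V)" and ?\<sigma> = "copies_rep m (dual_rep Q V \<rho>)"
  have ui: "u i \<in> carrier (dual V)" if "i < m" for i using u that by auto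
  show "fdvs ?U" using fdvs_copies(1)[OF fdvs_dual(1)[OF fdvs_V]] .
  show w: "(\<lambda>i\<in>{..<m}. \<beta> D (u i)) \<in> carrier ?U"
    using linear_actionD(5)[OF linear_action_\<beta> D] ui by auto
  fix \<Phi> assume \<Phi>: "\<Phi> \<in> carrier (dual ?U)"
  obtain \<phi> where \<phi>: "\<forall>i<m. \<phi> i \<in> carrier (dual (dual V))"
    and \<Phi>_sum: "\<forall>u\<in>carrier ?U. \<Phi> u = (\<Sum>i<m. \<phi> i (u i))"
    using vectorspace_dual[OF vectorspace_V] \<Phi> by (rule dual_copies)
  have "\<exists>v\<in>carrier V. \<forall>\<xi>\<in>carrier (dual V). \<phi> i \<xi> = \<xi> v" if i: "i < m" for i
    by (rule double_dual[OF fdvs_V \<phi>[rule_format, OF i]]) blast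
  then obtain v where v: "\<And>i. i < m \<Longrightarrow> v i \<in> carrier V"
    and \<phi>v: "\<And>i \<xi>. i < m \<Longrightarrow> \<xi> \<in> carrier (dual V) \<Longrightarrow> \<phi> i \<xi> = \<xi> (v i)"
    by metis
  have \<Phi>_eval: "\<Phi> u = (\<Sum>i<m. u i (v i))" if "u \<in> carrier ?U" for u
    unfolding \<Phi>_sum[rule_format, OF that] by (rule sum.cong) (use that \<phi>v in auto)
  have "\<Phi> (\<lambda>i\<in>{..<m}. \<beta> D (u i)) = (\<Sum>i<m. - D (mc (u i) (v i)) \<one>)"
    unfolding \<Phi>_eval[OF w]
    by (rule sum.cong) (simp_all add: dual_act_def v d\<rho>(2)[OF D] ui)
  also have "\<dots> = (\<Sum>i<m. D (finv (mc (u i) (v i))) \<one>)"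
    by (rule sum.cong) (simp_all add: L_finv[OF D mc_A] ui v)
  also have "\<dots> = D (\<lambda>x\<in>carrier Q. \<Sum>i<m. finv (mc (u i) (v i)) x) \<one>"
    by (rule L_sum[OF D one_closed, symmetric]) (simp add: A_finv mc_A ui v)
  also have "(\<lambda>x\<in>carrier Q. \<Sum>i<m. finv (mc (u i) (v i)) x) = matrix_coeff Q ?\<sigma> \<Phi> u"
    unfolding matrix_coeff_def[of Q ?\<sigma>]
  proof (rule restrict_ext)
    fix x assume x: "x \<in> carrier Q"
    have \<sigma>: "?\<sigma> x u \<in> carrier ?U"
      using dual_rep_closed[OF x] ui by (auto simp: copies_rep_def)
    show "(\<Sum>i<m. finv (mc (u i) (v i)) x) = \<Phi> (?\<sigma> x u)"
      unfolding \<Phi>_eval[OF \<sigma>]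
      by (rule sum.cong) (simp_all add: x copies_rep_def dual_rep_def v)
  qed
  finally show "\<Phi> (\<lambda>i\<in>{..<m}. \<beta> D (u i)) = D (matrix_coeff Q ?\<sigma> \<Phi> u) \<one>" .
qed

end

text \<open>The value nm - dim q cannot hold for every representation: if \<open>\<rho>\<close> is
  trivial, then q acts by zero and the index is nm, even for nonzero q. Hence the second conjunct
  carries the kernel of the differential, and the third is the formula for an injective
  differential. Good index behaviour holds in either case.\<close>

theorem theorem1p4:
  fixes Q :: "('g, 'z) monoid_scheme"
    and A :: "('g \<Rightarrow> 'k :: {alg_closed_field, field_char_0}) set"
    and V :: "('k, 'v) module"
    and \<rho> :: "'g \<Rightarrow> 'v \<Rightarrow> 'v"
    and n m :: nat
  assumes "affine_algebraic_group Q A"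
    and "rational_rep Q A V \<rho>"
    and "vdim V = n"
    and "m \<ge> n"
  shows "good_index_behaviour Q A (copies m (dual V)) (copies_rep m (dual_rep Q V \<rho>)) \<and>
    ind (lie_algebra_of Q A) (copies m (dual V))
        (differential Q (copies m (dual V)) (copies_rep m (dual_rep Q V \<rho>)))
      = int (n * m) - (int (vdim (lie_algebra_of Q A)) - int (vdim (differential_kernel Q A V \<rho>))) \<and>
    (carrier (differential_kernel Q A V \<rho>) = {\<zero>\<^bsub>lie_algebra_of Q A\<^esub>} \<longrightarrow>
      ind (lie_algebra_of Q A) (copies m (dual V))
          (differential Q (copies m (dual V)) (copies_rep m (dual_rep Q V \<rho>)))
        = int (n * m) - int (vdim (lie_algebra_of Q A)))"
proof -
  interpret affine_group_representation Q A V \<rho>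
    using assms(1,2) by (simp add: affine_group_representation_def affine_group_representation_axioms_def)
  let ?act = "differential Q (copies m (dual V)) (copies_rep m (dual_rep Q V \<rho>))"
  have dim: "vdim (dual V) = n" using fdvs_dual(2)[OF fdvs_V] assms(3) by simp
  \<comment> \<open>The commutator of derivations is the element demanded by \<open>bracket\<close>,
    and \<open>differential_copies_dual\<close> gives the slotwise action on tuples.\<close>
  interpret C: copies_action L "dual V" \<beta> m ?act
  proof
    show "\<exists>z\<in>carrier L. \<forall>w\<in>carrier (dual V). \<beta> x (\<beta> y w) = \<beta> z w \<oplus>\<^bsub>dual V\<^esub> \<beta> y (\<beta> x w)"
      if "x \<in> carrier L" "y \<in> carrier L" for x y
      using \<beta>_bracket commutator_L that by blast
  qed (use linear_action_\<beta> differential_copies_dual dim assms(4) in simp_all)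
  have K: "differential_kernel Q A V \<rho> = L\<lparr>carrier := C.K\<rparr>"
    unfolding differential_kernel_def C.K_def \<beta>_kernel ..
  have ind: "ind L (copies m (dual V)) ?act =
      int (n * m) - (int (vdim L) - int (vdim (differential_kernel Q A V \<rho>)))"
    using C.ind_copies unfolding K C.U_def dim by (simp add: mult.commute)
  moreover have "good_index_behaviour Q A (copies m (dual V)) (copies_rep m (dual_rep Q V \<rho>))"
    using C.ind_dual_copies C.ind_dual_slice
    unfolding good_index_behaviour_def Let_def C.U_def by simp
  moreover have "vdim (differential_kernel Q A V \<rho>) = 0"
    if "carrier (differential_kernel Q A V \<rho>) = {\<zero>\<^bsub>L\<^esub>}"
  proof (rule vdim_zero_space)
    have "subspace class_ring {\<zero>\<^bsub>L\<^esub>} L"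
      using vectorspace_class_ringD(1,6,13)[OF vectorspace_L]
      by (intro subspace_class_ringI vectorspace_L) auto
    then show "vectorspace class_ring (differential_kernel Q A V \<rho>)"
      using that vectorspace.subspace_is_vs[OF vectorspace_L] unfolding K by simp
    show "carrier (differential_kernel Q A V \<rho>) = {\<zero>\<^bsub>differential_kernel Q A V \<rho>\<^esub>}"
      using that by (simp add: K)
  qed
  ultimately show ?thesis by simp
qed

end
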